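(* Let $W$ be an admissible family and let $M=M(b;(a_1,b_1),(a_2,b_2),(a_3,b_3))$ be a negative definite Seifert manifold with $b_1(M)=0$. Let $|H|=|H_1(M;\mathbb{Z})|$, $A=a_1a_2a_3$, $\overline{a_i}=A/a_i$, and $$f_0(t,z)=\frac{\prod_{i=1}^3\left(z^{\overline{a_i}}t^{-1}-z^{-\overline{a_i}}t\right)}{z^{A}t^{-1}-z^{-A}t}.$$ Then $$P^{\infty}_{W,0}(M)(t^2,q^{|H|})=q^{\Delta}\,\mathcal{L}_A\big(\mathrm{a.e.}_{W_3(1)}(f_0(t,z))\big),$$ where $\Delta\in\mathbb{Q}$ is the number, determined by the plumbing and independent of $W$, given in the context.
   Context: **Plumbing.** A plumbing tree $\Gamma$ is a finite tree with $s$ ordered vertices $v_i$ carrying integer weights $m_i$; $m=(m_i)\in\mathbb{Z}^s$, $\delta\in\mathbb{Z}^s$ is the vector of vertex degrees, $u=(1,\dots,1)$. The plumbing matrix, also denoted $M$, has $M_{ii}=m_i$, $M_{ij}=1$ if $v_i,v_j$ are joined by an edge, and $0$ otherwise. The manifold (obtained by Dehn surgery on the associated framed link of clasped unknots) is negative definite if the matrix $M$ is; then $|H_1(M;\mathbb{Z})|=|\det M|$. **Seifert manifolds.** For coprime pairs $(a_i,b_i)$ with $a_i>0$, the plumbing tree of $M(b;(a_1,b_1),(a_2,b_2),(a_3,b_3))$ has one node of weight $-b$ and degree $3$ with three linear legs; going outwards from the node, leg $i$ has weights $-c^i_1,\dots,-c^i_{\ell_i}$, where $\frac{a_i}{b_i}=c^i_1-\cfrac{1}{c^i_2-\cfrac{1}{\ddots-\cfrac{1}{c^i_{\ell_i}}}}$.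 Vertices are indexed $0,\dots,s-1$: $0$ is the node, $1,2,3$ are the leaves (leaf $i$ at the end of leg $i$), the rest are the degree-2 vertices. **Admissible families.** An admissible family is a family of functions $W=\{W_n:\mathbb{Z}\to\frac12\mathbb{Z}\}_{n\in\mathbb{N}}$ ($n\ge0$) such that $W_2(0)=1$, $W_2(r)=0$ for $r\ne0$, and $W_n(r+1)-W_n(r-1)=W_{n-1}(r)$ for all $n\ge1$, $r\in\mathbb{Z}$. **The invariant.** Spin$^c$ structures are identified with classes $[k]\in(m+2\mathbb{Z}^s)/2M\mathbb{Z}^s$. Write $\langle x,y\rangle=x^tMy$ and let $\cdot$ be the Euclidean inner product. For $x\in\mathbb{Z}^s$ put $\chi_k(x)=-\frac{k\cdot x+\langle x,x\rangle}{2}$, $\Theta_k=\frac{k\cdot u-\langle u,u\rangle}{2}$, $W_{\Gamma,k}(x)=\prod_iW_{\delta_i}((2Mx+k-Mu)_i)$, and $$\varepsilon_k(x)=-\frac{(k-Mu)^tM^{-1}(k-Mu)+3s+\sum_i m_i}{4}+2\chi_k(x)+\langle x,u\rangle.$$ Then $P^\infty_{W,[k]}(M)(t,q)=\sum_{x\in\mathbb{Z}^s}W_{\Gamma,k}(x)q^{\varepsilon_k(x)}t^{\Theta_k+\langle x,u\rangle}$, which depends only on $[k]$, and $P^\infty_{W,0}(M)(t,q)=\sum_{[k]}P^\infty_{W,[k]}(M)(t,q)$, the sum over all spin$^c$ structures. **Asymmetric expansion.** If $f$ has Laurent expansions $\sum_k a_kz^k$ centered at $z=0$ and $\sum_k b_kz^{-k}$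 centered at $z=\infty$, then for $y\in\mathbb{R}$, $\mathrm{a.e.}_y(f)=(1-y)\sum_k a_kz^k+y\sum_k b_kz^{-k}$ as a formal series. For $f_0(t,z)$ these are the expansions in the regions $|z^At^{-1}|<1$ and $|z^At^{-1}|>1$. **Laplace transform.** $\mathcal{L}_A$ is the linear map on formal series sending $z^nt^r\mapsto q^{n^2/(4A)}t^r$. **Prefactor.** With $M'=(-1)^s\,\mathrm{adj}(M)$ (adjugate matrix), $$\Delta=-\frac{|H|\,(3s+\mathrm{Tr}\,M)}{4}-\frac14\sum_{i=1}^3\left(M'_{ii}+\frac{A}{a_i^2}\right).$$ *)

theory Defs
  imports
    "HOL-Analysis.Infinite_Sum"
    "Jordan_Normal_Form.DL_Rank"
    "Jordan_Normal_Form.Gauss_Jordan_Elimination"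
    "Jordan_Normal_Form.Determinant"
begin

section \<open>Plumbing graphs\<close>

text \<open>The vertices are \<open>0, \<dots>, nverts - 1\<close>; an edge is a two-element set of vertices.\<close>

record plumbing =
  nverts :: nat
  weight :: "nat \<Rightarrow> int"
  edges :: "nat set set"

definition vertex_degree :: "plumbing \<Rightarrow> nat \<Rightarrow> nat" where
  "vertex_degree \<Gamma> i = card {j. j < nverts \<Gamma> \<and> {i, j} \<in> edges \<Gamma>}"

definition plumbing_mat :: "plumbing \<Rightarrow> int mat" where
  "plumbing_mat \<Gamma> = mat (nverts \<Gamma>) (nverts \<Gamma>)
     (\<lambda>(i, j). if i = j then weight \<Gamma> i else if {i, j} \<in> edges \<Gamma> then 1 else 0)"

definition plumbing_inv :: "plumbing \<Rightarrow> rat mat" where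
  "plumbing_inv \<Gamma> = the (mat_inverse (map_mat rat_of_int (plumbing_mat \<Gamma>)))"

definition negative_definite :: "plumbing \<Rightarrow> bool" where
  "negative_definite \<Gamma> \<longleftrightarrow>
     (\<forall>x \<in> carrier_vec (nverts \<Gamma>). x \<noteq> 0\<^sub>v (nverts \<Gamma>) \<longrightarrow>
        x \<bullet> (map_mat real_of_int (plumbing_mat \<Gamma>) *\<^sub>v x) < 0)"

text \<open>The plumbed manifold of a tree has first homology \<open>\<int>\<^sup>s / M \<int>\<^sup>s\<close>, where \<open>M\<close> is the plumbing
  matrix. Hence its first Betti number is the corank of \<open>M\<close>, and its first homology has order
  \<open>\<bar>det M\<bar>\<close> if this number is nonzero.\<close>

definition betti_1 :: "plumbing \<Rightarrow> nat" where
  "betti_1 \<Gamma> = nverts \<Gamma> - vec_space.rank (nverts \<Gamma>) (map_mat rat_of_int (plumbing_mat \<Gamma>))"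

definition H1_order :: "plumbing \<Rightarrow> int" where
  "H1_order \<Gamma> = \<bar>det (plumbing_mat \<Gamma>)\<bar>"

section \<open>Seifert manifolds with three singular fibres\<close>

fun neg_cfrac :: "int list \<Rightarrow> rat" where
  "neg_cfrac [] = 0"
| "neg_cfrac [c] = rat_of_int c"
| "neg_cfrac (c # cs) = rat_of_int c - 1 / neg_cfrac cs"

text \<open>\<open>seifert_plumbing b a \<beta> \<Gamma>\<close>: \<open>\<Gamma>\<close> is a plumbing tree of \<open>M(b; (a\<^sub>1, \<beta>\<^sub>1), (a\<^sub>2, \<beta>\<^sub>2), (a\<^sub>3, \<beta>\<^sub>3))\<close>.
  The list \<open>c i\<close> holds the negated weights of leg \<open>i\<close>, going outwards from the node, and
  \<open>pos i j\<close> is the vertex at (zero-based) position \<open>j\<close> of that leg. Vertex \<open>0\<close> is the node and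
  vertex \<open>i \<in> {1, 2, 3}\<close> is the leaf of leg \<open>i\<close>; the order of the remaining vertices is arbitrary.\<close>

definition seifert_plumbing ::
    "int \<Rightarrow> (nat \<Rightarrow> int) \<Rightarrow> (nat \<Rightarrow> int) \<Rightarrow> plumbing \<Rightarrow> bool" where
  "seifert_plumbing b a \<beta> \<Gamma> \<longleftrightarrow>
     (\<exists>(c :: nat \<Rightarrow> int list) (pos :: nat \<Rightarrow> nat \<Rightarrow> nat).
        (\<forall>i \<in> {1, 2, 3}. c i \<noteq> [] \<and> rat_of_int (a i) / rat_of_int (\<beta> i) = neg_cfrac (c i)) \<and>
        nverts \<Gamma> = 1 + (\<Sum>i \<in> {1, 2, 3}. length (c i)) \<and>
        bij_betw (\<lambda>(i, j). pos i j) (SIGMA i : {1, 2, 3}. {..<length (c i)}) {1..<nverts \<Gamma>} \<and>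
        (\<forall>i \<in> {1, 2, 3}. pos i (length (c i) - 1) = i) \<and>
        weight \<Gamma> 0 = - b \<and>
        (\<forall>i \<in> {1, 2, 3}. \<forall>j < length (c i). weight \<Gamma> (pos i j) = - (c i ! j)) \<and>
        edges \<Gamma> = {{0, pos i 0} | i. i \<in> {1, 2, 3}} \<union>
                  {{pos i j, pos i (Suc j)} | i j. i \<in> {1, 2, 3} \<and> Suc j < length (c i)})"

section \<open>Admissible families\<close>

definition admissible_family :: "(nat \<Rightarrow> int \<Rightarrow> real) \<Rightarrow> bool" where
  "admissible_family W \<longleftrightarrow>
     (\<forall>n r. 2 * W n r \<in> \<int>) \<and>
     W 2 0 = 1 \<and> (\<forall>r. r \<noteq> 0 \<longrightarrow> W 2 r = 0) \<and>
     (\<forall>n \<ge> 1. \<forall>r. W n (r + 1) - W n (r - 1) = W (n - 1) r)"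

section \<open>Formal series in \<open>q\<close> and \<open>t\<close>\<close>

text \<open>A formal series assigns to \<open>(e, r)\<close> the coefficient of \<open>q\<^sup>e t\<^sup>r\<close>; exponents are rational.\<close>

type_synonym qt_series = "rat \<times> rat \<Rightarrow> real"

text \<open>\<open>monomial_sum I w e r\<close> is \<open>\<Sum>i\<in>I. w i * q\<^bsup>e i\<^esup> * t\<^bsup>r i\<^esup>\<close>. It is meaningful when, for each monomial,
  only finitely many \<open>i\<close> with \<open>w i \<noteq> 0\<close> contribute to it.\<close>

definition monomial_sum ::
    "'i set \<Rightarrow> ('i \<Rightarrow> real) \<Rightarrow> ('i \<Rightarrow> rat) \<Rightarrow> ('i \<Rightarrow> rat) \<Rightarrow> qt_series" where
  "monomial_sum I w e r = (\<lambda>(\<alpha>, \<beta>). \<Sum>i \<in> {i \<in> I. w i \<noteq> 0 \<and> e i = \<alpha> \<and> r i = \<beta>}. w i)"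

text \<open>The substitution \<open>q \<mapsto> q\<^sup>h\<close>, \<open>t \<mapsto> t\<^sup>d\<close> for nonzero \<open>h\<close>, \<open>d\<close>.\<close>

definition subst_powers :: "rat \<Rightarrow> rat \<Rightarrow> qt_series \<Rightarrow> qt_series" where
  "subst_powers h d F = (\<lambda>(\<alpha>, \<beta>). F (\<alpha> / h, \<beta> / d))"

definition q_power_times :: "rat \<Rightarrow> qt_series \<Rightarrow> qt_series" where
  "q_power_times \<Delta> F = (\<lambda>(\<alpha>, \<beta>). F (\<alpha> - \<Delta>, \<beta>))"

section \<open>The invariant\<close>

definition ones :: "plumbing \<Rightarrow> int vec" where
  "ones \<Gamma> = vec (nverts \<Gamma>) (\<lambda>_. 1)"

definition lat_form :: "plumbing \<Rightarrow> int vec \<Rightarrow> int vec \<Rightarrow> int" where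
  "lat_form \<Gamma> x y = x \<bullet> (plumbing_mat \<Gamma> *\<^sub>v y)"

definition chi :: "plumbing \<Rightarrow> int vec \<Rightarrow> int vec \<Rightarrow> rat" where
  "chi \<Gamma> k x = - rat_of_int (k \<bullet> x + lat_form \<Gamma> x x) / 2"

definition Theta :: "plumbing \<Rightarrow> int vec \<Rightarrow> rat" where
  "Theta \<Gamma> k = rat_of_int (k \<bullet> ones \<Gamma> - lat_form \<Gamma> (ones \<Gamma>) (ones \<Gamma>)) / 2"

definition W_graph :: "(nat \<Rightarrow> int \<Rightarrow> real) \<Rightarrow> plumbing \<Rightarrow> int vec \<Rightarrow> int vec \<Rightarrow> real" where
  "W_graph W \<Gamma> k x =
     (\<Prod>i < nverts \<Gamma>. W (vertex_degree \<Gamma> i)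
        ((2 \<cdot>\<^sub>v (plumbing_mat \<Gamma> *\<^sub>v x) + k - plumbing_mat \<Gamma> *\<^sub>v ones \<Gamma>) $ i))"

definition eps :: "plumbing \<Rightarrow> int vec \<Rightarrow> int vec \<Rightarrow> rat" where
  "eps \<Gamma> k x =
     (let v = map_vec rat_of_int (k - plumbing_mat \<Gamma> *\<^sub>v ones \<Gamma>)
      in - (v \<bullet> (plumbing_inv \<Gamma> *\<^sub>v v) + 3 * of_nat (nverts \<Gamma>)
              + rat_of_int (\<Sum>i < nverts \<Gamma>. weight \<Gamma> i)) / 4
         + 2 * chi \<Gamma> k x + rat_of_int (lat_form \<Gamma> x (ones \<Gamma>)))"

definition P_inf_rep :: "(nat \<Rightarrow> int \<Rightarrow> real) \<Rightarrow> plumbing \<Rightarrow> int vec \<Rightarrow> qt_series" where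
  "P_inf_rep W \<Gamma> k =
     monomial_sum (carrier_vec (nverts \<Gamma>)) (W_graph W \<Gamma> k) (eps \<Gamma> k)
       (\<lambda>x. Theta \<Gamma> k + rat_of_int (lat_form \<Gamma> x (ones \<Gamma>)))"

definition char_vectors :: "plumbing \<Rightarrow> int vec set" where
  "char_vectors \<Gamma> = {k \<in> carrier_vec (nverts \<Gamma>). \<forall>i < nverts \<Gamma>. even (k $ i - weight \<Gamma> i)}"

definition spinc :: "plumbing \<Rightarrow> int vec set set" where
  "spinc \<Gamma> = char_vectors \<Gamma> //
     {(k, k'). k \<in> char_vectors \<Gamma> \<and> k' \<in> char_vectors \<Gamma> \<and>
        (\<exists>x \<in> carrier_vec (nverts \<Gamma>). k' = k + 2 \<cdot>\<^sub>v (plumbing_mat \<Gamma> *\<^sub>v x))}"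

text \<open>\<open>P_inf_rep W \<Gamma> k\<close> depends only on the class of \<open>k\<close>, so the choice of \<open>k\<close> is immaterial.\<close>

definition P_inf :: "(nat \<Rightarrow> int \<Rightarrow> real) \<Rightarrow> plumbing \<Rightarrow> int vec set \<Rightarrow> qt_series" where
  "P_inf W \<Gamma> K = P_inf_rep W \<Gamma> (SOME k. k \<in> K)"

definition P_inf_0 :: "(nat \<Rightarrow> int \<Rightarrow> real) \<Rightarrow> plumbing \<Rightarrow> qt_series" where
  "P_inf_0 W \<Gamma> = (\<lambda>p. \<Sum>K \<in> spinc \<Gamma>. P_inf W \<Gamma> K p)"

section \<open>Asymmetric expansion and Laplace transform\<close>

text \<open>A formal series in \<open>z\<close> and \<open>t\<close> assigns to \<open>(n, r)\<close> the coefficient of \<open>z\<^sup>n t\<^sup>r\<close>.\<close>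

type_synonym zt_series = "int \<times> int \<Rightarrow> real"

text \<open>The Laurent expansion of \<open>f\<close> in a region \<open>D\<close> of pairs \<open>(t, z)\<close> with \<open>t \<noteq> 0\<close> and \<open>z \<noteq> 0\<close>.\<close>

definition laurent_expansion ::
    "(complex \<times> complex) set \<Rightarrow> (complex \<Rightarrow> complex \<Rightarrow> complex) \<Rightarrow> zt_series" where
  "laurent_expansion D f =
     (THE c. \<forall>(t, z) \<in> D.
        ((\<lambda>(n, r). complex_of_real (c (n, r)) * z powi n * t powi r) has_sum f t z) UNIV)"

text \<open>\<open>asym_expansion A y f\<close> is \<open>a.e.\<^sub>y(f)\<close>; the two regions are \<open>\<bar>z\<^sup>A t\<^sup>-\<^sup>1\<bar> < 1\<close>, for the expansion
  centred at \<open>z = 0\<close>, and \<open>\<bar>z\<^sup>A t\<^sup>-\<^sup>1\<bar> > 1\<close>, for the expansion centred at \<open>z = \<infinity>\<close>.\<close>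

definition asym_expansion ::
    "int \<Rightarrow> real \<Rightarrow> (complex \<Rightarrow> complex \<Rightarrow> complex) \<Rightarrow> zt_series" where
  "asym_expansion A y f = (\<lambda>p.
     (1 - y) * laurent_expansion {(t, z). t \<noteq> 0 \<and> z \<noteq> 0 \<and> norm (z powi A * inverse t) < 1} f p +
     y * laurent_expansion {(t, z). t \<noteq> 0 \<and> z \<noteq> 0 \<and> norm (z powi A * inverse t) > 1} f p)"

definition laplace :: "int \<Rightarrow> zt_series \<Rightarrow> qt_series" where
  "laplace A F = monomial_sum UNIV F
     (\<lambda>(n, r). rat_of_int (n\<^sup>2) / (4 * rat_of_int A)) (\<lambda>(n, r). rat_of_int r)"

definition prod_a :: "(nat \<Rightarrow> int) \<Rightarrow> int" where
  "prod_a a = (\<Prod>i \<in> {1, 2, 3}. a i)"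

definition f0 :: "(nat \<Rightarrow> int) \<Rightarrow> complex \<Rightarrow> complex \<Rightarrow> complex" where
  "f0 a t z =
     (\<Prod>i \<in> {1, 2, 3}. z powi (prod_a a div a i) * inverse t - z powi (- (prod_a a div a i)) * t) /
     (z powi (prod_a a) * inverse t - z powi (- prod_a a) * t)"

definition Delta :: "(nat \<Rightarrow> int) \<Rightarrow> plumbing \<Rightarrow> rat" where
  "Delta a \<Gamma> =
     (let s = nverts \<Gamma>; M' = (- 1) ^ s \<cdot>\<^sub>m adj_mat (plumbing_mat \<Gamma>)
      in - rat_of_int (H1_order \<Gamma>) * (3 * of_nat s + rat_of_int (\<Sum>i < s. plumbing_mat \<Gamma> $$ (i, i))) / 4
         - (1 / 4) * (\<Sum>i \<in> {1, 2, 3}.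
             rat_of_int (M' $$ (i, i)) + rat_of_int (prod_a a) / (rat_of_int (a i))\<^sup>2))"

end

theory Submission
  imports Defs
begin

text \<open>
  Write \<open>l = 2Mx + k - Mu\<close>. Since \<open>Mu = m + \<delta>\<close>, and since a spin-c structure is a class of vectors
  \<open>k \<equiv> m (mod 2)\<close> modulo \<open>2M\<int>\<^sup>s\<close>, the vector \<open>l\<close> runs exactly once through all vectors
  \<open>l \<equiv> \<delta> (mod 2)\<close> when \<open>k\<close> runs through representatives of the spin-c structures and \<open>x\<close> through
  \<open>\<int>\<^sup>s\<close>. Completing the square turns the exponents of a summand into functions of \<open>l\<close> alone: the
  exponent of \<open>q\<close> is \<open>-(l\<^sup>tM\<^sup>-\<^sup>1l + 3s + Tr M)/4\<close>, that of \<open>t\<close> is \<open>(l \<cdot> u)/2\<close>, and the coefficient is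
  \<open>\<Prod>\<^sub>i W\<^bsub>\<delta>\<^sub>i\<^esub>(l\<^sub>i)\<close>.

  In an admissible family \<open>W\<^sub>2\<close> is supported at \<open>0\<close>, and the recursion forces \<open>W\<^sub>1\<close> to be \<open>1\<close> at \<open>-1\<close>, \<open>-1\<close>
  at \<open>1\<close> and \<open>0\<close> elsewhere, and \<open>W\<^sub>3\<close> to be constant on the positive odd integers and on the negative
  ones, with jump \<open>1\<close>. So only the vectors with an odd entry \<open>n\<close> at the node, signs \<open>e\<^sub>1, e\<^sub>2, e\<^sub>3\<close> at the
  leaves and \<open>0\<close> elsewhere contribute (\<open>W_graph_nonzero\<close>, \<open>W_graph_leaf_vec\<close>).

  On these vectors the quadratic form of \<open>M' = \<bar>H\<bar>M\<^sup>-\<^sup>1\<close> needs only the entries of \<open>M'\<close> at the node and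
  the leaves. They are \<open>M'\<^sub>0\<^sub>0 = -A\<close>, \<open>M'\<^sub>0\<^sub>i = -A/a\<^sub>i\<close> and \<open>M'\<^sub>i\<^sub>j = -A/(a\<^sub>ia\<^sub>j)\<close> for \<open>i \<noteq> j\<close>, so that
  \<open>l\<^sup>tM'l = -A(n + \<Sum>\<^sub>ie\<^sub>i/a\<^sub>i)\<^sup>2 + \<Sum>\<^sub>i(M'\<^sub>i\<^sub>i + A/a\<^sub>i\<^sup>2)\<close>.
  The square is the exponent \<open>(An + \<Sum>\<^sub>ie\<^sub>iA/a\<^sub>i)\<^sup>2/(4A)\<close> produced by the Laplace transform, and the
  remainder goes into \<open>\<Delta>\<close> (\<open>quadratic_form_leaf_vec\<close>, \<open>eps_leaf_vec\<close>). The entries of \<open>M'\<close> are read off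
  from explicit solutions of linear systems whose entries are continuants of the legs; the same
  vectors, arranged as a matrix that is triangular with respect to the distance from the node, give
  \<open>det M\<close> (\<open>det_M\<close>).

  On the other side, with \<open>y = z\<^sup>-\<^sup>At\<close> the function \<open>f\<^sub>0\<close> is a finite sum over the signs \<open>e\<close>, divided by
  \<open>y - y\<^sup>-\<^sup>1\<close>. The two geometric series for this quotient run over the negative and over the positive odd
  powers of \<open>y\<close>; weighted with \<open>1 - W\<^sub>3(1)\<close> and \<open>W\<^sub>3(1)\<close> they reproduce the two constant values of
  \<open>W\<^sub>3\<close> (\<open>asym_expansion_f0\<close>). Both sides are thus the same sum over pairs \<open>(n, e)\<close>.
\<close>

section \<open>Continuants\<close>

text \<open>The determinant of the tridiagonal matrix with diagonal \<open>cs\<close> and \<open>-1\<close> next to the diagonal, that is,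
  of the negated plumbing matrix of a chain with weights \<open>-cs\<close>.\<close>

fun continuant :: "int list \<Rightarrow> int" where
  "continuant [] = 1"
| "continuant [c] = c"
| "continuant (c # d # cs) = c * continuant (d # cs) - continuant cs"

text \<open>Continuants can be expanded at either end. The recursion at the far end gives the vectors that solve
  the linear system of a leg when one starts at the node.\<close>

lemma continuant_snoc: "continuant (cs @ [c, d]) = d * continuant (cs @ [c]) - continuant cs"
proof (induction cs rule: continuant.induct)
  case (3 x y cs)
  have "continuant ((x # y # cs) @ [c, d]) =
        x * continuant ((y # cs) @ [c, d]) - continuant (cs @ [c, d])" by simp
  also have "\<dots> = d * (x * continuant ((y # cs) @ [c]) - continuant (cs @ [c])) -
                   (x * continuant (y # cs) - continuant cs)"
    unfolding 3 by (simp add: algebra_simps)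
  finally show ?case by simp
qed (auto simp: algebra_simps)

text \<open>The values \<open>1\<close> and \<open>0\<close> at the two positions behind the last one are boundary values that make
  the three-term recursion uniform up to the leaf.\<close>

definition tail_cont :: "int list \<Rightarrow> nat \<Rightarrow> int" where
  "tail_cont cs p = (if p \<le> length cs then continuant (drop p cs) else 0)"

lemma tail_cont_length [simp]: "tail_cont cs (length cs) = 1"
  by (simp add: tail_cont_def)

lemma tail_cont_0 [simp]: "tail_cont cs 0 = continuant cs"
  by (simp add: tail_cont_def)

lemma tail_cont_rec:
  assumes "p < length cs"
  shows "tail_cont cs p = cs ! p * tail_cont cs (Suc p) - tail_cont cs (Suc (Suc p))"
proof -
  have d: "drop p cs = cs ! p # drop (Suc p) cs" using assms by (simp add: Cons_nth_drop_Suc)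
  show ?thesis
  proof (cases "Suc p < length cs")
    case True
    then have "drop (Suc p) cs = cs ! Suc p # drop (Suc (Suc p)) cs"
      by (simp add: Cons_nth_drop_Suc)
    then show ?thesis using assms True d by (simp add: tail_cont_def)
  next
    case False
    then show ?thesis using assms d by (simp add: tail_cont_def)
  qed
qed

definition head_cont :: "int list \<Rightarrow> nat \<Rightarrow> int" where
  "head_cont cs p = continuant (take p cs)"

lemma head_cont_rec:
  assumes "p < length cs"
  shows "head_cont cs (Suc p) = cs ! p * head_cont cs p - (if p = 0 then 0 else head_cont cs (p - 1))"
proof (cases p)
  case 0
  then show ?thesis using assms by (simp add: head_cont_def take_Suc_conv_app_nth)
next
  case (Suc q)
  then have "take (Suc p) cs = take q cs @ [cs ! q, cs ! p]" "take p cs = take q cs @ [cs ! q]"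
    using assms by (simp_all add: take_Suc_conv_app_nth)
  then show ?thesis using Suc continuant_snoc[of "take q cs" "cs ! q" "cs ! p"]
    by (simp add: head_cont_def)
qed

text \<open>The recursion is a step of the Euclidean algorithm.\<close>

lemma coprime_continuant_tl:
  "cs \<noteq> [] \<Longrightarrow> coprime (continuant cs) (continuant (tl cs))"
proof (induction cs rule: continuant.induct)
  case (3 c d cs)
  have IH: "coprime (continuant (d # cs)) (continuant cs)" using 3 by simp
  have "gcd (c * continuant (d # cs) - continuant cs) (continuant (d # cs)) =
        gcd (- continuant cs) (continuant (d # cs))"
    using gcd_add_mult[of "continuant (d # cs)" c "- continuant cs"]
    by (simp add: gcd.commute mult.commute)
  then show ?case using IH by (simp add: coprime_iff_gcd_eq_1 gcd.commute)
qed auto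

text \<open>Positivity of the continuants of all tails keeps every denominator of the continued fraction
  nonzero.\<close>

lemma neg_cfrac_eq_continuants:
  assumes "cs \<noteq> []" "\<And>p. p \<le> length cs \<Longrightarrow> tail_cont cs p > 0"
  shows "neg_cfrac cs = rat_of_int (continuant cs) / rat_of_int (continuant (tl cs))"
  using assms
proof (induction cs rule: neg_cfrac.induct)
  case (3 c d cs)
  have pos: "tail_cont (d # cs) p > 0" if "p \<le> length (d # cs)" for p
    using 3(3)[of "Suc p"] that by (simp add: tail_cont_def)
  have "neg_cfrac (d # cs) = rat_of_int (continuant (d # cs)) / rat_of_int (continuant cs)"
    using 3(1) pos by simp
  moreover have "continuant (d # cs) > 0" using pos[of 0] by simp
  ultimately show ?case by (simp add: field_simps)
qed auto

text \<open>Compares the diagonals of the two triangular matrices used to compute \<open>det M\<close>.\<close>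

lemma prod_tail_cont_telescope:
  "(\<Prod>p<length cs. tail_cont cs p) = continuant cs * (\<Prod>p<length cs. tail_cont cs (Suc p))"
  using prod.lessThan_Suc_shift[of "tail_cont cs" "length cs"]
  by (simp add: lessThan_Suc)

section \<open>Determinants of triangular shape\<close>

text \<open>The nonzero entries may only lie on the diagonal or lead to an index of higher rank. A permutation
  preserves the sum of the ranks, so in the Leibniz formula only the identity has a nonzero product.
  The rank \<open>r\<close> replaces a sorting of the indices, which would be awkward because the vertices of a
  plumbing tree are numbered arbitrarily.\<close>

lemma det_triangular_wrt_rank:
  fixes r :: "nat \<Rightarrow> int" and A :: "'a :: comm_ring_1 mat"
  assumes A: "A \<in> carrier_mat n n"
    and tri: "\<And>i j. i < n \<Longrightarrow> j < n \<Longrightarrow> A $$ (i, j) \<noteq> 0 \<Longrightarrow> i = j \<or> r i < r j"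
  shows "det A = (\<Prod>i<n. A $$ (i, i))"
proof -
  have zero: "(\<Prod>i = 0..<n. A $$ (i, p i)) = 0" if p: "p permutes {0..<n}" "p \<noteq> id" for p
  proof (rule ccontr)
    assume "(\<Prod>i = 0..<n. A $$ (i, p i)) \<noteq> 0"
    then have nz: "A $$ (i, p i) \<noteq> 0" if "i < n" for i
      using that prod_zero[of "{0..<n}" "\<lambda>i. A $$ (i, p i)"]
      by (metis atLeastLessThan_iff finite_atLeastLessThan le0)
    have pn: "p i < n" if "i < n" for i
      using permutes_in_image[OF p(1), of i] that by simp
    have le: "i = p i \<or> r i < r (p i)" if "i < n" for i
      using tri[OF that pn[OF that] nz[OF that]] .
    obtain k where k: "p k \<noteq> k" using p(2) by (auto simp: fun_eq_iff)
    then have kn: "k < n" using permutes_not_in[OF p(1), of k] by fastforce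
    have "(\<Sum>i = 0..<n. r i) < (\<Sum>i = 0..<n. r (p i))"
    proof (rule sum_strict_mono_ex1)
      show "\<forall>i\<in>{0..<n}. r i \<le> r (p i)" using le by fastforce
      show "\<exists>i\<in>{0..<n}. r i < r (p i)" using le[OF kn] k kn by (intro bexI[of _ k]) auto
    qed simp
    then show False using sum.permute[OF p(1), of r] by (simp add: comp_def)
  qed
  have "det A = (\<Sum>p\<in>{p. p permutes {0..<n}}. signof p * (\<Prod>i = 0..<n. A $$ (i, p i)))"
    by (rule det_def'[OF A])
  also have "\<dots> = (\<Sum>p\<in>{id}. signof p * (\<Prod>i = 0..<n. A $$ (i, p i)))"
    by (rule sum.mono_neutral_right) (auto simp: zero permutes_id finite_permutations)
  finally show ?thesis by (simp add: signof_id atLeast0LessThan)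
qed

section \<open>Star-shaped plumbing trees\<close>

text \<open>A constant of its own keeps the simplifier from expanding sums over the legs.\<close>

definition legs :: "nat set" where
  "legs = {1, 2, 3}"

lemma finite_legs [simp]: "finite legs" by (simp add: legs_def)

lemma card_legs: "card legs = 3" by (simp add: legs_def)

lemma sum_legs: "(\<Sum>i\<in>legs. g i) = g 1 + g 2 + (g 3 :: 'a :: comm_monoid_add)"
  by (simp add: legs_def add.assoc)

lemma prod_legs: "(\<Prod>i\<in>legs. g i) = g 1 * g 2 * (g 3 :: 'a :: comm_monoid_mult)"
  by (simp add: legs_def mult.assoc)

text \<open>Fixes the weights \<open>c\<close> and the numbering \<open>pos\<close> of the legs, whose existence a Seifert plumbing
  asserts.\<close>

locale star_plumbing =
  fixes \<Gamma> :: plumbing and b :: int and a \<beta> :: "nat \<Rightarrow> int"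
    and c :: "nat \<Rightarrow> int list" and pos :: "nat \<Rightarrow> nat \<Rightarrow> nat"
  assumes a_pos: "i \<in> legs \<Longrightarrow> a i > 0"
    and a_coprime: "i \<in> legs \<Longrightarrow> coprime (a i) (\<beta> i)"
    and c_nonempty: "i \<in> legs \<Longrightarrow> c i \<noteq> []"
    and c_cfrac: "i \<in> legs \<Longrightarrow> rat_of_int (a i) / rat_of_int (\<beta> i) = neg_cfrac (c i)"
    and nverts_eq: "nverts \<Gamma> = 1 + (\<Sum>i \<in> legs. length (c i))"
    and pos_bij: "bij_betw (\<lambda>(i, j). pos i j) (SIGMA i : legs. {..<length (c i)}) {1..<nverts \<Gamma>}"
    and pos_leaf: "i \<in> legs \<Longrightarrow> pos i (length (c i) - 1) = i"
    and weight_node: "weight \<Gamma> 0 = - b"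
    and weight_pos: "i \<in> legs \<Longrightarrow> j < length (c i) \<Longrightarrow> weight \<Gamma> (pos i j) = - (c i ! j)"
    and edges_eq: "edges \<Gamma> = {{0, pos i 0} | i. i \<in> legs} \<union>
                  {{pos i j, pos i (Suc j)} | i j. i \<in> legs \<and> Suc j < length (c i)}"
    and neg_def: "negative_definite \<Gamma>"
begin

abbreviation "s \<equiv> nverts \<Gamma>"
abbreviation "M \<equiv> plumbing_mat \<Gamma>"

text \<open>The leg and the position of a vertex other than the node.\<close>

definition lab :: "nat \<Rightarrow> nat \<times> nat" where
  "lab = inv_into (SIGMA i : legs. {..<length (c i)}) (\<lambda>(i, j). pos i j)"

lemma lab_pos:
  assumes "i \<in> legs" "p < length (c i)"
  shows "lab (pos i p) = (i, p)"
proof -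
  have "(i, p) \<in> (SIGMA i : legs. {..<length (c i)})" using assms by auto
  from inv_into_f_f[OF bij_betw_imp_inj_on[OF pos_bij] this] show ?thesis
    by (simp add: lab_def)
qed

lemma pos_range:
  assumes "i \<in> legs" "p < length (c i)"
  shows "0 < pos i p" "pos i p < s"
proof -
  have "(i, p) \<in> (SIGMA i : legs. {..<length (c i)})" using assms by auto
  from bij_betwE[OF pos_bij, rule_format, OF this] show "0 < pos i p" "pos i p < s" by auto
qed

lemma pos_eq_iff:
  assumes "i \<in> legs" "p < length (c i)" "j \<in> legs" "q < length (c j)"
  shows "pos i p = pos j q \<longleftrightarrow> i = j \<and> p = q"
  using lab_pos[OF assms(1,2)] lab_pos[OF assms(3,4)] by (metis prod.inject)

lemma s_pos: "0 < s" using nverts_eq by simp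

lemma len_pos: "i \<in> legs \<Longrightarrow> 0 < length (c i)" using c_nonempty by simp

lemma vertex_cases:
  assumes "v < s"
  obtains (node) "v = 0" | (leg) i p where "i \<in> legs" "p < length (c i)" "v = pos i p"
proof (cases "v = 0")
  case False
  then have "v \<in> (\<lambda>(i, j). pos i j) ` (SIGMA i : legs. {..<length (c i)})"
    using assms bij_betw_imp_surj_on[OF pos_bij] by auto
  then show ?thesis using leg by auto
qed (use node in auto)

lemma all_vertices:
  assumes "P 0" "\<And>i p. i \<in> legs \<Longrightarrow> p < length (c i) \<Longrightarrow> P (pos i p)" "v < s"
  shows "P v"
  using assms(3) by (cases rule: vertex_cases) (use assms(1,2) in auto)

lemma vertices_split: "{..<s} = insert 0 ((\<lambda>(i, j). pos i j) ` (SIGMA i : legs. {..<length (c i)}))"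
  using bij_betw_imp_surj_on[OF pos_bij] s_pos by auto

lemma sum_vertices:
  "(\<Sum>v<s. g v) = g 0 + (\<Sum>i\<in>legs. \<Sum>p<length (c i). (g (pos i p) :: 'b :: comm_monoid_add))"
proof -
  have "(\<Sum>v<s. g v) = g 0 + (\<Sum>v\<in>(\<lambda>(i, j). pos i j) ` (SIGMA i : legs. {..<length (c i)}). g v)"
    unfolding vertices_split by (subst sum.insert) (fastforce dest: pos_range(1))+
  also have "(\<Sum>v\<in>(\<lambda>(i, j). pos i j) ` (SIGMA i : legs. {..<length (c i)}). g v) =
     (\<Sum>x\<in>(SIGMA i : legs. {..<length (c i)}). g (pos (fst x) (snd x)))"
    by (subst sum.reindex[OF bij_betw_imp_inj_on[OF pos_bij]]) (simp add: case_prod_beta comp_def)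
  also have "\<dots> = (\<Sum>i\<in>legs. \<Sum>p<length (c i). g (pos i p))"
    by (subst sum.Sigma) (auto simp: case_prod_beta)
  finally show ?thesis .
qed

lemma prod_vertices:
  "(\<Prod>v<s. g v) = g 0 * (\<Prod>i\<in>legs. \<Prod>p<length (c i). (g (pos i p) :: 'b :: comm_monoid_mult))"
proof -
  have "(\<Prod>v<s. g v) = g 0 * (\<Prod>v\<in>(\<lambda>(i, j). pos i j) ` (SIGMA i : legs. {..<length (c i)}). g v)"
    unfolding vertices_split by (subst prod.insert) (fastforce dest: pos_range(1))+
  also have "(\<Prod>v\<in>(\<lambda>(i, j). pos i j) ` (SIGMA i : legs. {..<length (c i)}). g v) =
     (\<Prod>x\<in>(SIGMA i : legs. {..<length (c i)}). g (pos (fst x) (snd x)))"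
    by (subst prod.reindex[OF bij_betw_imp_inj_on[OF pos_bij]]) (simp add: case_prod_beta comp_def)
  also have "\<dots> = (\<Prod>i\<in>legs. \<Prod>p<length (c i). g (pos i p))"
    by (subst prod.Sigma) (auto simp: case_prod_beta)
  finally show ?thesis .
qed

lemma edge_node_iff:
  assumes "i \<in> legs" "p < length (c i)"
  shows "{0, pos i p} \<in> edges \<Gamma> \<longleftrightarrow> p = 0"
proof
  assume "{0, pos i p} \<in> edges \<Gamma>"
  then consider j where "j \<in> legs" "{0, pos i p} = {0, pos j 0}"
    | j q where "j \<in> legs" "Suc q < length (c j)" "{0, pos i p} = {pos j q, pos j (Suc q)}"
    unfolding edges_eq by blast
  then show "p = 0"
  proof cases
    case 1
    then have "pos i p = pos j 0" using pos_range(1)[OF assms] by (auto simp: doubleton_eq_iff)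
    then show ?thesis using pos_eq_iff[OF assms 1(1) len_pos[OF 1(1)]] by simp
  next
    case 2
    then show ?thesis using pos_range(1)[OF 2(1), of q] pos_range(1)[OF 2(1), of "Suc q"]
      by (auto simp: doubleton_eq_iff)
  qed
next
  assume "p = 0"
  then show "{0, pos i p} \<in> edges \<Gamma>" unfolding edges_eq using assms by blast
qed

lemma edge_leg_iff:
  assumes "i \<in> legs" "p < length (c i)" "j \<in> legs" "q < length (c j)"
  shows "{pos i p, pos j q} \<in> edges \<Gamma> \<longleftrightarrow> i = j \<and> (q = Suc p \<or> p = Suc q)"
proof
  assume "{pos i p, pos j q} \<in> edges \<Gamma>"
  then consider k where "k \<in> legs" "{pos i p, pos j q} = {0, pos k 0}"
    | k l where "k \<in> legs" "Suc l < length (c k)" "{pos i p, pos j q} = {pos k l, pos k (Suc l)}"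
    unfolding edges_eq by blast
  then show "i = j \<and> (q = Suc p \<or> p = Suc q)"
  proof cases
    case 1
    then show ?thesis using pos_range(1)[OF assms(1,2)] pos_range(1)[OF assms(3,4)]
      by (auto simp: doubleton_eq_iff)
  next
    case 2
    then have "(pos i p = pos k l \<and> pos j q = pos k (Suc l)) \<or>
               (pos i p = pos k (Suc l) \<and> pos j q = pos k l)"
      by (auto simp: doubleton_eq_iff)
    then show ?thesis
      using pos_eq_iff[OF assms(1,2) 2(1), of l] pos_eq_iff[OF assms(1,2) 2(1), of "Suc l"]
        pos_eq_iff[OF assms(3,4) 2(1), of l] pos_eq_iff[OF assms(3,4) 2(1), of "Suc l"] 2(2)
      by auto
  qed
next
  assume "i = j \<and> (q = Suc p \<or> p = Suc q)"
  then show "{pos i p, pos j q} \<in> edges \<Gamma>"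
  proof (elim conjE disjE)
    assume "i = j" "q = Suc p"
    then show ?thesis unfolding edges_eq using assms by blast
  next
    assume "i = j" "p = Suc q"
    then have "{pos i p, pos j q} = {pos i q, pos i (Suc q)}" by auto
    then show ?thesis unfolding edges_eq using assms \<open>i = j\<close> \<open>p = Suc q\<close> by blast
  qed
qed

lemma M_carrier [simp]: "M \<in> carrier_mat s s" by (simp add: plumbing_mat_def)

lemma M_dims [simp]: "dim_row M = s" "dim_col M = s" by (simp_all add: plumbing_mat_def)

lemma M_symmetric: "i < s \<Longrightarrow> j < s \<Longrightarrow> M $$ (i, j) = M $$ (j, i)"
  by (simp add: plumbing_mat_def insert_commute)

lemma M_transpose: "transpose_mat M = M"
  by (rule eq_matI) (auto simp: M_symmetric)

lemma M_self_adjoint: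
  assumes "x \<in> carrier_vec s" "y \<in> carrier_vec s"
  shows "(M *\<^sub>v x) \<bullet> y = x \<bullet> (M *\<^sub>v y)"
  using transpose_vec_mult_scalar[OF M_carrier assms(2,1)] by (simp add: M_transpose)

lemma M_entry_node: "M $$ (0, 0) = - b"
  using s_pos by (simp add: plumbing_mat_def weight_node)

lemma M_entry_node_leg:
  assumes "i \<in> legs" "p < length (c i)"
  shows "M $$ (0, pos i p) = (if p = 0 then 1 else 0)"
  using s_pos pos_range[OF assms] edge_node_iff[OF assms] by (simp add: plumbing_mat_def)

lemma M_entry_leg_leg:
  assumes "i \<in> legs" "p < length (c i)" "j \<in> legs" "q < length (c j)"
  shows "M $$ (pos i p, pos j q) =
    (if i = j then if p = q then - (c i ! p) else if q = Suc p \<or> p = Suc q then 1 else 0 else 0)"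
proof -
  have "M $$ (pos i p, pos j q) = (if pos i p = pos j q then weight \<Gamma> (pos i p)
      else if {pos i p, pos j q} \<in> edges \<Gamma> then 1 else 0)"
    using pos_range(2)[OF assms(1,2)] pos_range(2)[OF assms(3,4)] by (simp add: plumbing_mat_def)
  then show ?thesis
    unfolding pos_eq_iff[OF assms] edge_leg_iff[OF assms] weight_pos[OF assms(1,2)] by simp
qed

lemma M_mult_index:
  "v < s \<Longrightarrow> row M v \<bullet> vec s f = (\<Sum>w<s. M $$ (v, w) * f w)"
  by (simp add: scalar_prod_def row_def atLeast0LessThan)

lemma M_mult_node: "row M 0 \<bullet> vec s f = - b * f 0 + (\<Sum>i\<in>legs. f (pos i 0))"
proof -
  have "(\<Sum>p<length (c i). M $$ (0, pos i p) * f (pos i p)) = f (pos i 0)" if "i \<in> legs" for i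
  proof -
    have "(\<Sum>p<length (c i). M $$ (0, pos i p) * f (pos i p)) =
          (\<Sum>p<length (c i). if p = 0 then f (pos i p) else 0)"
      by (rule sum.cong) (auto simp: M_entry_node_leg[OF that])
    also have "\<dots> = f (pos i 0)" using len_pos[OF that] by (subst sum.delta) auto
    finally show ?thesis .
  qed
  then show ?thesis using s_pos by (simp add: M_mult_index sum_vertices M_entry_node)
qed

text \<open>Row \<open>pos i p\<close> of \<open>M\<close> has entries at the vertex, at its neighbour towards the node (the node itself if
  \<open>p = 0\<close>) and at its neighbour towards the leaf, if there is one.\<close>

lemma M_mult_leg:
  assumes i: "i \<in> legs" and p: "p < length (c i)"
  shows "row M (pos i p) \<bullet> vec s f = - (c i ! p) * f (pos i p)
     + (if p = 0 then f 0 else f (pos i (p - 1)))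
     + (if Suc p < length (c i) then f (pos i (Suc p)) else 0)"
proof -
  have other: "(\<Sum>q<length (c j). M $$ (pos i p, pos j q) * f (pos j q)) = 0" if "j \<in> legs - {i}" for j
    by (rule sum.neutral) (use that M_entry_leg_leg[OF i p] in auto)
  have "(\<Sum>q<length (c i). M $$ (pos i p, pos i q) * f (pos i q)) =
     (\<Sum>q<length (c i). (if q = p then - (c i ! p) * f (pos i p) else 0) +
        (if q = p - 1 then if p = 0 then 0 else f (pos i (p - 1)) else 0) +
        (if q = Suc p then f (pos i (Suc p)) else 0))"
    by (rule sum.cong) (auto simp: M_entry_leg_leg[OF i p i])
  also have "\<dots> = - (c i ! p) * f (pos i p) + (if p = 0 then 0 else f (pos i (p - 1)))
     + (if Suc p < length (c i) then f (pos i (Suc p)) else 0)"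
    unfolding sum.distrib using p by (auto simp: sum.delta)
  finally have own: "(\<Sum>q<length (c i). M $$ (pos i p, pos i q) * f (pos i q)) = \<dots>" .
  have "(\<Sum>j\<in>legs. \<Sum>q<length (c j). M $$ (pos i p, pos j q) * f (pos j q)) =
        (\<Sum>q<length (c i). M $$ (pos i p, pos i q) * f (pos i q))"
    using i other by (subst sum.remove[OF _ i]) (simp_all add: sum.neutral)
  moreover have "M $$ (pos i p, 0) = (if p = 0 then 1 else 0)"
    using M_entry_node_leg[OF i p] M_symmetric[OF pos_range(2)[OF i p] s_pos] by simp
  ultimately show ?thesis
    using pos_range(2)[OF i p] own by (simp add: M_mult_index sum_vertices)
qed

lemma vertex_degree_node: "vertex_degree \<Gamma> 0 = 3"
proof -
  have "{j. j < s \<and> {0, j} \<in> edges \<Gamma>} = (\<lambda>i. pos i 0) ` legs"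
  proof (intro equalityI subsetI)
    fix j assume j: "j \<in> {j. j < s \<and> {0, j} \<in> edges \<Gamma>}"
    then have "j < s" by simp
    then show "j \<in> (\<lambda>i. pos i 0) ` legs"
    proof (cases rule: vertex_cases)
      case node
      then have "{0, 0} \<in> edges \<Gamma>" using j by simp
      then show ?thesis using pos_range(1) len_pos
        unfolding edges_eq by (fastforce simp: doubleton_eq_iff)
    next
      case (leg i p)
      then show ?thesis using j edge_node_iff by auto
    qed
  next
    fix j assume "j \<in> (\<lambda>i. pos i 0) ` legs"
    then show "j \<in> {j. j < s \<and> {0, j} \<in> edges \<Gamma>}"
      using edge_node_iff pos_range(2) len_pos by auto
  qed
  moreover have "inj_on (\<lambda>i. pos i 0) legs"
    using pos_eq_iff len_pos by (intro inj_onI) blast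
  ultimately show ?thesis by (simp add: vertex_degree_def card_image card_legs)
qed

lemma vertex_degree_leg:
  assumes i: "i \<in> legs" and p: "p < length (c i)"
  shows "vertex_degree \<Gamma> (pos i p) = (if Suc p < length (c i) then 2 else 1)"
proof -
  define u where "u = (if p = 0 then 0 else pos i (p - 1))"
  have nbr: "{pos i p, j} \<in> edges \<Gamma> \<longleftrightarrow> j = u \<or> (Suc p < length (c i) \<and> j = pos i (Suc p))"
    if "j < s" for j
    using that
  proof (cases rule: vertex_cases)
    case node
    then show ?thesis
      using edge_node_iff[OF i p] pos_range(1)[OF i, of "p - 1"] pos_range(1)[OF i, of "Suc p"] p
      by (auto simp: u_def insert_commute)
  next
    case (leg k q)
    then show ?thesis
      using edge_leg_iff[OF i p leg(1,2)] pos_eq_iff[OF leg(1,2) i, of "p - 1"]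
        pos_eq_iff[OF leg(1,2) i, of "Suc p"] pos_range(1)[OF leg(1,2)] p
      by (auto simp: u_def)
  qed
  have u: "u < s" using s_pos pos_range(2)[OF i, of "p - 1"] p by (simp add: u_def)
  show ?thesis
  proof (cases "Suc p < length (c i)")
    case True
    have "{j. j < s \<and> {pos i p, j} \<in> edges \<Gamma>} = {u, pos i (Suc p)}"
      using nbr True u pos_range(2)[OF i True] by auto
    moreover have "u \<noteq> pos i (Suc p)"
      using pos_range(1)[OF i True] pos_eq_iff[OF i _ i True, of "p - 1"] p by (auto simp: u_def)
    ultimately show ?thesis using True by (simp add: vertex_degree_def)
  next
    case False
    then have "{j. j < s \<and> {pos i p, j} \<in> edges \<Gamma>} = {u}" using nbr u by auto
    then show ?thesis using False by (simp add: vertex_degree_def)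
  qed
qed

section \<open>Linear systems along the legs\<close>

lemma M_negative:
  assumes x: "x \<in> carrier_vec s" and nz: "x \<noteq> 0\<^sub>v s"
  shows "x \<bullet> (M *\<^sub>v x) < 0"
proof -
  let ?r = "map_vec real_of_int"
  have "?r x \<noteq> 0\<^sub>v s"
  proof
    assume eq: "?r x = 0\<^sub>v s"
    have "x = 0\<^sub>v s"
    proof (rule eq_vecI)
      fix i assume "i < dim_vec (0\<^sub>v s :: int vec)"
      then show "x $ i = 0\<^sub>v s $ i" using arg_cong[OF eq, of "\<lambda>v. v $ i"] x by simp
    qed (use x in simp)
    then show False using nz by simp
  qed
  then have "?r x \<bullet> (map_mat real_of_int M *\<^sub>v ?r x) < 0"
    using neg_def x by (simp add: negative_definite_def)
  also have "map_mat real_of_int M *\<^sub>v ?r x = ?r (M *\<^sub>v x)"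
    by (rule of_int_hom.mult_mat_vec_hom[OF M_carrier x, symmetric])
  also have "?r x \<bullet> ?r (M *\<^sub>v x) = real_of_int (x \<bullet> (M *\<^sub>v x))"
    using x by (simp add: scalar_prod_def)
  finally show ?thesis by simp
qed

definition leg_vec :: "int \<Rightarrow> (nat \<Rightarrow> nat \<Rightarrow> int) \<Rightarrow> nat \<Rightarrow> int" where
  "leg_vec x f v = (if v = 0 then x else f (fst (lab v)) (snd (lab v)))"

lemma leg_vec_0 [simp]: "leg_vec x f 0 = x" by (simp add: leg_vec_def)

lemma leg_vec_pos [simp]: "i \<in> legs \<Longrightarrow> p < length (c i) \<Longrightarrow> leg_vec x f (pos i p) = f i p"
  using pos_range(1)[of i p] by (simp add: leg_vec_def lab_pos)

lemma M_mult_leg_vec: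
  assumes "- b * x + (\<Sum>i\<in>legs. f i 0) = y"
    and "\<And>i p. i \<in> legs \<Longrightarrow> p < length (c i) \<Longrightarrow>
       - (c i ! p) * f i p + (if p = 0 then x else f i (p - 1)) +
       (if Suc p < length (c i) then f i (Suc p) else 0) = g i p"
  shows "M *\<^sub>v vec s (leg_vec x f) = vec s (leg_vec y g)"
proof (rule eq_vecI)
  fix v assume "v < dim_vec (vec s (leg_vec y g))"
  then have v: "v < s" by simp
  then have "row M v \<bullet> vec s (leg_vec x f) = leg_vec y g v"
  proof (cases rule: vertex_cases)
    case node
    then show ?thesis using assms(1) len_pos by (simp add: M_mult_node)
  next
    case (leg i p)
    then show ?thesis using assms(2)[OF leg(1,2)] by (auto simp: M_mult_leg)
  qed
  then show "(M *\<^sub>v vec s (leg_vec x f)) $ v = vec s (leg_vec y g) $ v" using v by simp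
qed simp

text \<open>Supported on leg \<open>i\<close> from position \<open>p\<close> outwards, with the continuants of the remaining tails as
  entries: the three-term recursion makes \<open>M\<close> annihilate it everywhere except at position \<open>p\<close> and at the
  vertex before it.\<close>

definition outer_fun :: "nat \<Rightarrow> nat \<Rightarrow> nat \<Rightarrow> int" where
  "outer_fun i p = leg_vec 0 (\<lambda>j q. if j = i \<and> p \<le> q then tail_cont (c i) (Suc q) else 0)"

definition outer_image :: "nat \<Rightarrow> nat \<Rightarrow> nat \<Rightarrow> int" where
  "outer_image i p = leg_vec (if p = 0 then tail_cont (c i) 1 else 0)
     (\<lambda>j q. if j \<noteq> i then 0 else if q = p then - tail_cont (c i) p
            else if Suc q = p then tail_cont (c i) (Suc p) else 0)"

lemma M_outer:
  assumes i: "i \<in> legs" and p: "p < length (c i)"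
  shows "M *\<^sub>v vec s (outer_fun i p) = vec s (outer_image i p)"
  unfolding outer_fun_def outer_image_def
proof (rule M_mult_leg_vec)
  show "- b * 0 + (\<Sum>j\<in>legs. if j = i \<and> p \<le> 0 then tail_cont (c i) (Suc 0) else 0) =
     (if p = 0 then tail_cont (c i) 1 else 0)"
    using i by (simp add: sum.delta)
next
  fix j q assume "j \<in> legs" and q: "q < length (c j)"
  consider "j \<noteq> i" | "j = i" "Suc q < p" | "j = i" "Suc q = p" | "j = i" "q = p" | "j = i" "p < q"
    by linarith
  then show "- (c j ! q) * (if j = i \<and> p \<le> q then tail_cont (c i) (Suc q) else 0) +
       (if q = 0 then 0 else if j = i \<and> p \<le> q - 1 then tail_cont (c i) (Suc (q - 1)) else 0) +
       (if Suc q < length (c j)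
        then if j = i \<and> p \<le> Suc q then tail_cont (c i) (Suc (Suc q)) else 0 else 0) =
       (if j \<noteq> i then 0 else if q = p then - tail_cont (c i) p
        else if Suc q = p then tail_cont (c i) (Suc p) else 0)"
  proof cases
    case 4
    then show ?thesis using tail_cont_rec[of p "c i"] p by (auto simp: tail_cont_def)
  next
    case 5
    then have "tail_cont (c i) (Suc (q - 1)) = tail_cont (c i) q" by simp
    then show ?thesis using 5 tail_cont_rec[of q "c i"] q by (auto simp: tail_cont_def)
  qed (use p in auto)
qed

text \<open>Evaluating the negative definite form at \<open>outer_fun i p\<close> gives minus the product of two consecutive
  tail continuants, so positivity spreads from the leaf to the node.\<close>

lemma tail_cont_pos:
  assumes i: "i \<in> legs" and "p \<le> length (c i)"
  shows "tail_cont (c i) p > 0"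
  using assms(2)
proof (induction p rule: inc_induct)
  case base
  then show ?case by simp
next
  case (step p)
  let ?x = "vec s (outer_fun i p)"
  have pl: "p < length (c i)" using step by simp
  have val: "outer_fun i p (pos i p) = tail_cont (c i) (Suc p)"
    using i pl by (simp add: outer_fun_def)
  have "?x \<bullet> vec s (outer_image i p) = (\<Sum>v<s. outer_fun i p v * outer_image i p v)"
    by (simp add: scalar_prod_def atLeast0LessThan)
  also have "\<dots> = (\<Sum>v<s. if v = pos i p then - tail_cont (c i) p * tail_cont (c i) (Suc p) else 0)"
  proof (rule sum.cong[OF refl])
    fix v assume "v \<in> {..<s}"
    then have "v < s" by simp
    then show "outer_fun i p v * outer_image i p v =
      (if v = pos i p then - tail_cont (c i) p * tail_cont (c i) (Suc p) else 0)"
    proof (cases rule: vertex_cases)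
      case node
      then show ?thesis using pos_range(1)[OF i pl] by (simp add: outer_fun_def)
    next
      case (leg j q)
      then show ?thesis using pos_eq_iff[OF leg(1,2) i pl]
        by (auto simp: outer_fun_def outer_image_def)
    qed
  qed
  also have "\<dots> = - tail_cont (c i) p * tail_cont (c i) (Suc p)"
    using pos_range(2)[OF i pl] by (simp add: sum.delta)
  finally have eq: "?x \<bullet> (M *\<^sub>v ?x) = - tail_cont (c i) p * tail_cont (c i) (Suc p)"
    unfolding M_outer[OF i pl] .
  have "?x $ pos i p \<noteq> 0\<^sub>v s $ pos i p" using pos_range(2)[OF i pl] val step.IH by simp
  then have "?x \<noteq> 0\<^sub>v s" by metis
  then have "?x \<bullet> (M *\<^sub>v ?x) < 0" by (intro M_negative) simp_all
  then have "0 < tail_cont (c i) p * tail_cont (c i) (Suc p)" unfolding eq by simp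
  then show ?case using step.IH by (simp add: zero_less_mult_iff)
qed

text \<open>Both \<open>a\<^sub>i/\<beta>\<^sub>i\<close> and the quotient of continuants are in lowest terms with positive numerator. The
  case \<open>\<beta>\<^sub>i = 0\<close>, where the quotient has the default value \<open>0\<close>, is excluded by positivity.\<close>

lemma a_eq_continuant:
  assumes i: "i \<in> legs"
  shows "a i = continuant (c i)"
proof -
  have "tl (c i) = drop 1 (c i)" by (simp add: drop_Suc)
  then have den: "continuant (tl (c i)) > 0"
    using tail_cont_pos[OF i, of 1] len_pos[OF i] by (simp add: tail_cont_def)
  have num: "continuant (c i) > 0" using tail_cont_pos[OF i, of 0] by simp
  have eq: "rat_of_int (a i) / rat_of_int (\<beta> i) =
      rat_of_int (continuant (c i)) / rat_of_int (continuant (tl (c i)))"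
    using c_cfrac[OF i] neg_cfrac_eq_continuants[OF c_nonempty[OF i]] tail_cont_pos[OF i] by simp
  have "\<beta> i \<noteq> 0" using eq num den by auto
  then have "rat_of_int (a i * continuant (tl (c i))) = rat_of_int (continuant (c i) * \<beta> i)"
    using eq den by (simp add: field_simps)
  then have cross: "a i * continuant (tl (c i)) = continuant (c i) * \<beta> i"
    by (simp only: of_int_eq_iff)
  have "a i dvd continuant (c i)"
    using cross a_coprime[OF i] by (metis coprime_dvd_mult_left_iff dvd_triv_left)
  moreover have "continuant (c i) dvd a i"
    using cross coprime_continuant_tl[OF c_nonempty[OF i]]
    by (metis coprime_dvd_mult_left_iff dvd_triv_left)
  ultimately show ?thesis using a_pos[OF i] num by (simp add: zdvd_antisym_nonneg)
qed

abbreviation "A \<equiv> prod_a a"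

abbreviation abar :: "nat \<Rightarrow> int" where "abar i \<equiv> A div a i"

lemma A_eq: "A = a 1 * a 2 * a 3"
  by (simp add: prod_a_def mult.assoc)

lemma A_prod: "A = (\<Prod>i\<in>legs. a i)"
  by (simp add: A_eq prod_legs)

lemma A_pos: "A > 0"
  using a_pos by (simp add: A_eq legs_def)

lemma a_abar: "i \<in> legs \<Longrightarrow> a i * abar i = A"
  using a_pos by (intro dvd_mult_div_cancel) (auto simp: A_eq legs_def)

text \<open>This is \<open>A(b - \<Sum>\<^sub>i \<beta>\<^sub>i/a\<^sub>i)\<close>, the usual formula for the order of the first homology of a Seifert
  manifold; it arises here as the value at the node of \<open>M\<close> applied to \<open>node_fun\<close>.\<close>

definition h :: int where
  "h = b * A - (\<Sum>i\<in>legs. abar i * tail_cont (c i) 1)"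

text \<open>The column of \<open>M'\<close> that belongs to the node.\<close>

definition node_fun :: "nat \<Rightarrow> int" where
  "node_fun = leg_vec (- A) (\<lambda>i p. - (abar i * tail_cont (c i) (Suc p)))"

lemma M_node: "M *\<^sub>v vec s node_fun = vec s (leg_vec h (\<lambda>_ _. 0))"
  unfolding node_fun_def
proof (rule M_mult_leg_vec)
  show "- b * - A + (\<Sum>i\<in>legs. - (abar i * tail_cont (c i) (Suc 0))) = h"
    by (simp add: h_def sum_negf)
next
  fix i p assume i: "i \<in> legs" and p: "p < length (c i)"
  have parent: "(if p = 0 then - A else - (abar i * tail_cont (c i) (Suc (p - 1)))) =
      - (abar i * tail_cont (c i) p)"
    using a_abar[OF i] a_eq_continuant[OF i] by (cases p) (simp_all add: mult.commute)
  have child: "(if Suc p < length (c i) then - (abar i * tail_cont (c i) (Suc (Suc p))) else 0) =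
      - (abar i * tail_cont (c i) (Suc (Suc p)))"
    using p by (auto simp: tail_cont_def)
  show "- (c i ! p) * - (abar i * tail_cont (c i) (Suc p)) +
      (if p = 0 then - A else - (abar i * tail_cont (c i) (Suc (p - 1)))) +
      (if Suc p < length (c i) then - (abar i * tail_cont (c i) (Suc (Suc p))) else 0) = 0"
    unfolding parent child tail_cont_rec[OF p] by (simp add: algebra_simps)
qed

lemma node_delta: "v < s \<Longrightarrow> leg_vec x (\<lambda>_ _. 0) v = (if v = 0 then x else 0)"
  by (simp add: leg_vec_def)

text \<open>The form takes the value \<open>-Ah\<close> at \<open>node_fun\<close>.\<close>

lemma h_pos: "h > 0"
proof -
  let ?x = "vec s node_fun"
  have "?x \<bullet> (M *\<^sub>v ?x) = (\<Sum>v<s. node_fun v * (if v = 0 then h else 0))"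
    unfolding M_node by (simp add: scalar_prod_def atLeast0LessThan node_delta)
  also have "\<dots> = (\<Sum>v<s. if v = 0 then node_fun v * h else 0)"
    by (rule sum.cong) auto
  also have "\<dots> = - A * h" using s_pos by (simp add: sum.delta node_fun_def)
  finally have eq: "?x \<bullet> (M *\<^sub>v ?x) = - A * h" .
  have "?x $ 0 \<noteq> 0\<^sub>v s $ 0" using s_pos A_pos by (simp add: node_fun_def)
  then have "?x \<noteq> 0\<^sub>v s" by metis
  then have "?x \<bullet> (M *\<^sub>v ?x) < 0" by (intro M_negative) simp_all
  then show ?thesis unfolding eq using A_pos by (simp add: zero_less_mult_iff)
qed

text \<open>Supported on leg \<open>i\<close>, with the continuants of the initial segments as entries: \<open>M\<close> annihilates it
  everywhere except at the node and at the leaf \<open>i\<close>. It therefore links the column of \<open>M'\<close> at leaf \<open>i\<close>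
  with the column at the node.\<close>

definition head_fun :: "nat \<Rightarrow> nat \<Rightarrow> int" where
  "head_fun i = leg_vec 0 (\<lambda>j q. if j = i then head_cont (c i) q else 0)"

lemma M_head:
  assumes i: "i \<in> legs"
  shows "M *\<^sub>v vec s (head_fun i) =
    vec s (leg_vec 1 (\<lambda>j q. if j = i \<and> Suc q = length (c i) then - a i else 0))"
  unfolding head_fun_def
proof (rule M_mult_leg_vec)
  show "- b * 0 + (\<Sum>j\<in>legs. if j = i then head_cont (c i) 0 else 0) = 1"
    using i by (simp add: head_cont_def)
next
  fix j q assume "j \<in> legs" and q: "q < length (c j)"
  consider "j \<noteq> i" | "j = i" "Suc q < length (c i)" | "j = i" "Suc q = length (c i)"
    using q by fastforce
  then show "- (c j ! q) * (if j = i then head_cont (c i) q else 0) +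
     (if q = 0 then 0 else if j = i then head_cont (c i) (q - 1) else 0) +
     (if Suc q < length (c j) then if j = i then head_cont (c i) (Suc q) else 0 else 0) =
     (if j = i \<and> Suc q = length (c i) then - a i else 0)"
  proof cases
    case 2
    then show ?thesis using head_cont_rec[of q "c i"] q by auto
  next
    case 3
    then have "head_cont (c i) (Suc q) = a i" by (simp add: head_cont_def a_eq_continuant[OF i])
    then show ?thesis using 3 head_cont_rec[of q "c i"] q by auto
  qed simp
qed

section \<open>Determinant and inverse of the plumbing matrix\<close>

text \<open>Its columns are the vectors \<open>node_fun\<close> and \<open>outer_fun\<close>. Each is supported on a vertex and the part of
  the tree behind it, while \<open>M\<close> maps it to a vector supported on the vertex and its predecessor.
  Hence this matrix and its product with \<open>M\<close> are triangular in opposite senses with respect to the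
  depth.\<close>

definition tree_basis :: "int mat" where
  "tree_basis = mat s s (\<lambda>(u, v).
     if v = 0 then node_fun u else outer_fun (fst (lab v)) (snd (lab v)) u)"

definition depth :: "nat \<Rightarrow> int" where
  "depth = leg_vec 0 (\<lambda>_ p. int p + 1)"

lemma tree_basis_carrier: "tree_basis \<in> carrier_mat s s"
  by (simp add: tree_basis_def)

lemma M_tree_basis:
  assumes u: "u < s" and v: "v < s"
  shows "(M * tree_basis) $$ (u, v) =
    (if v = 0 then leg_vec h (\<lambda>_ _. 0) u else outer_image (fst (lab v)) (snd (lab v)) u)"
proof -
  have "(M * tree_basis) $$ (u, v) = (M *\<^sub>v col tree_basis v) $ u"
    using u v by (simp add: tree_basis_def)
  also have "col tree_basis v = vec s (if v = 0 then node_fun else outer_fun (fst (lab v)) (snd (lab v)))"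
    using v by (auto simp: tree_basis_def col_def)
  also have "M *\<^sub>v \<dots> = vec s (if v = 0 then leg_vec h (\<lambda>_ _. 0) else outer_image (fst (lab v)) (snd (lab v)))"
    using v
  proof (cases rule: vertex_cases)
    case node
    then show ?thesis by (simp add: M_node)
  next
    case (leg i p)
    then show ?thesis using pos_range(1)[OF leg(1,2)] by (simp add: lab_pos M_outer)
  qed
  finally show ?thesis using u by simp
qed

text \<open>Comparing the diagonals of \<open>tree_basis\<close> and \<open>M * tree_basis\<close>, all tail continuants cancel except
  those of the full legs, which are the \<open>a\<^sub>i\<close>.\<close>

lemma det_M: "det M = (- 1) ^ s * h"
proof -
  define Q where "Q = (\<Prod>i\<in>legs. \<Prod>p<length (c i). tail_cont (c i) (Suc p))"
  have "tail_cont (c i) (Suc p) \<noteq> 0" if "i \<in> legs" "p < length (c i)" for i p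
    using tail_cont_pos[OF that(1), of "Suc p"] that(2) by simp
  then have Q: "Q \<noteq> 0" by (simp add: Q_def)
  \<comment> \<open>The columns of \<open>tree_basis\<close> extend outwards, hence the reversed depth as rank.\<close>
  have "det tree_basis = (\<Prod>v<s. tree_basis $$ (v, v))"
  proof (rule det_triangular_wrt_rank[OF tree_basis_carrier, where r = "\<lambda>v. - depth v"])
    fix u v assume u: "u < s" and v: "v < s" and nz: "tree_basis $$ (u, v) \<noteq> 0"
    show "u = v \<or> - depth u < - depth v"
      using v
    proof (cases rule: vertex_cases)
      case node
      from u show ?thesis by (cases rule: vertex_cases) (auto simp: node depth_def)
    next
      case (leg i p)
      then have nz': "outer_fun i p u \<noteq> 0"
        using nz u v pos_range(1)[OF leg(1,2)] by (simp add: tree_basis_def lab_pos)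
      from u show ?thesis
      proof (cases rule: vertex_cases)
        case node
        then show ?thesis using nz' by (simp add: outer_fun_def)
      next
        case leg': (leg j q)
        then show ?thesis using nz' leg by (auto simp: outer_fun_def depth_def split: if_splits)
      qed
    qed
  qed
  also have "\<dots> = tree_basis $$ (0, 0) *
      (\<Prod>i\<in>legs. \<Prod>p<length (c i). tree_basis $$ (pos i p, pos i p))"
    by (rule prod_vertices)
  also have "(\<Prod>i\<in>legs. \<Prod>p<length (c i). tree_basis $$ (pos i p, pos i p)) = Q"
    unfolding Q_def
  proof (intro prod.cong refl)
    fix i p assume "i \<in> legs" "p \<in> {..<length (c i)}"
    then show "tree_basis $$ (pos i p, pos i p) = tail_cont (c i) (Suc p)"
      using pos_range[of i p] by (simp add: tree_basis_def lab_pos outer_fun_def)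
  qed
  also have "tree_basis $$ (0, 0) = - A" using s_pos by (simp add: tree_basis_def node_fun_def)
  finally have det_T: "det tree_basis = - A * Q" .
  have "det (M * tree_basis) = (\<Prod>v<s. (M * tree_basis) $$ (v, v))"
  proof (rule det_triangular_wrt_rank[where r = depth])
    fix u v assume u: "u < s" and v: "v < s" and nz: "(M * tree_basis) $$ (u, v) \<noteq> 0"
    show "u = v \<or> depth u < depth v"
      using v
    proof (cases rule: vertex_cases)
      case node
      then show ?thesis using nz M_tree_basis[OF u s_pos] node_delta[OF u, of h] by (auto split: if_splits)
    next
      case (leg i p)
      then have nz': "outer_image i p u \<noteq> 0"
        using nz u v pos_range(1)[OF leg(1,2)] by (simp add: M_tree_basis lab_pos)
      from u show ?thesis
      proof (cases rule: vertex_cases)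
        case node
        then show ?thesis using leg by (simp add: depth_def)
      next
        case leg': (leg j q)
        then show ?thesis using nz' leg by (auto simp: outer_image_def depth_def split: if_splits)
      qed
    qed
  qed (rule mult_carrier_mat[OF M_carrier tree_basis_carrier])
  also have "\<dots> = (M * tree_basis) $$ (0, 0) *
      (\<Prod>i\<in>legs. \<Prod>p<length (c i). (M * tree_basis) $$ (pos i p, pos i p))"
    by (rule prod_vertices)
  also have "(\<Prod>i\<in>legs. \<Prod>p<length (c i). (M * tree_basis) $$ (pos i p, pos i p)) =
      (\<Prod>i\<in>legs. \<Prod>p<length (c i). - tail_cont (c i) p)"
  proof (intro prod.cong refl)
    fix i p assume "i \<in> legs" "p \<in> {..<length (c i)}"
    then show "(M * tree_basis) $$ (pos i p, pos i p) = - tail_cont (c i) p"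
      using pos_range[of i p] by (simp add: M_tree_basis lab_pos outer_image_def)
  qed
  also have "\<dots> = (\<Prod>i\<in>legs. (- 1) ^ length (c i) * (a i * (\<Prod>p<length (c i). tail_cont (c i) (Suc p))))"
  proof (intro prod.cong refl)
    fix i assume i: "i \<in> legs"
    have "(\<Prod>p<length (c i). - tail_cont (c i) p) =
          (- 1) ^ length (c i) * (\<Prod>p<length (c i). tail_cont (c i) p)"
      by (simp add: prod_uminus)
    then show "(\<Prod>p<length (c i). - tail_cont (c i) p) =
      (- 1) ^ length (c i) * (a i * (\<Prod>p<length (c i). tail_cont (c i) (Suc p)))"
      by (simp add: prod_tail_cont_telescope a_eq_continuant[OF i])
  qed
  also have "\<dots> = (- 1) ^ (s - 1) * (A * Q)"
    unfolding prod.distrib Q_def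
    by (simp add: nverts_eq power_sum A_prod)
  also have "(M * tree_basis) $$ (0, 0) = h" using s_pos by (simp add: M_tree_basis)
  finally have det_MT: "det (M * tree_basis) = h * ((- 1) ^ (s - 1) * (A * Q))" .
  have sgn: "(- 1 :: int) ^ (s - 1) = - ((- 1) ^ s)" using s_pos by (cases s) simp_all
  have "det M * (- A * Q) = h * ((- 1) ^ (s - 1) * (A * Q))"
    using det_mult[OF M_carrier tree_basis_carrier] det_T det_MT by simp
  also have "\<dots> = ((- 1) ^ s * h) * (- A * Q)" unfolding sgn by simp
  finally show ?thesis using Q A_pos by simp
qed

lemma H1_order_eq: "H1_order \<Gamma> = h"
  using h_pos by (simp add: H1_order_def det_M abs_mult power_abs)

text \<open>Equal to \<open>\<bar>det M\<bar> \<cdot> M\<^sup>-\<^sup>1\<close>, because \<open>det M\<close> has the sign \<open>(-1)\<^sup>s\<close>.\<close>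

definition M' :: "int mat" where
  "M' = (- 1) ^ s \<cdot>\<^sub>m adj_mat M"

lemma M'_carrier [simp]: "M' \<in> carrier_mat s s"
  using adj_mat(1)[OF M_carrier] by (simp add: M'_def)

lemma M'_dims [simp]: "dim_row M' = s" "dim_col M' = s"
  using carrier_matD[OF M'_carrier] by simp_all

lemma sign_det: "(- 1) ^ s * det M = h"
  by (simp add: det_M mult.assoc[symmetric] power_mult_distrib[symmetric])

lemma M_M': "M * M' = h \<cdot>\<^sub>m 1\<^sub>m s"
proof -
  have "M * M' = (- 1) ^ s \<cdot>\<^sub>m (M * adj_mat M)"
    unfolding M'_def by (rule mult_smult_distrib[OF M_carrier adj_mat(1)[OF M_carrier]])
  then show ?thesis unfolding adj_mat(2)[OF M_carrier]
    by (intro eq_matI) (auto simp: sign_det mult.assoc[symmetric])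
qed

lemma M'_M: "M' * M = h \<cdot>\<^sub>m 1\<^sub>m s"
proof -
  have "M' * M = (- 1) ^ s \<cdot>\<^sub>m (adj_mat M * M)"
    unfolding M'_def by (rule mult_smult_assoc_mat[OF adj_mat(1)[OF M_carrier] M_carrier])
  then show ?thesis unfolding adj_mat(3)[OF M_carrier]
    by (intro eq_matI) (auto simp: sign_det mult.assoc[symmetric])
qed

lemma M'_M_vec:
  assumes "x \<in> carrier_vec s"
  shows "M' *\<^sub>v (M *\<^sub>v x) = h \<cdot>\<^sub>v x"
proof -
  have "M' *\<^sub>v (M *\<^sub>v x) = (h \<cdot>\<^sub>m 1\<^sub>m s) *\<^sub>v x"
    using assoc_mult_mat_vec[OF M'_carrier M_carrier assms] by (simp add: M'_M)
  also have "\<dots> = h \<cdot>\<^sub>v x" using assms by (intro eq_vecI) auto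
  finally show ?thesis .
qed

lemma M_M'_vec:
  assumes "x \<in> carrier_vec s"
  shows "M *\<^sub>v (M' *\<^sub>v x) = h \<cdot>\<^sub>v x"
proof -
  have "M *\<^sub>v (M' *\<^sub>v x) = (h \<cdot>\<^sub>m 1\<^sub>m s) *\<^sub>v x"
    using assoc_mult_mat_vec[OF M_carrier M'_carrier assms] by (simp add: M_M')
  also have "\<dots> = h \<cdot>\<^sub>v x" using assms by (intro eq_vecI) auto
  finally show ?thesis .
qed

lemma plumbing_inv_eq:
  "plumbing_inv \<Gamma> = (1 / rat_of_int h) \<cdot>\<^sub>m map_mat rat_of_int M'"
proof -
  let ?R = "map_mat rat_of_int M" and ?R' = "map_mat rat_of_int M'"
  let ?B = "(1 / rat_of_int h) \<cdot>\<^sub>m ?R'"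
  have R: "?R \<in> carrier_mat s s" and R': "?R' \<in> carrier_mat s s" and B: "?B \<in> carrier_mat s s"
    by simp_all
  have one: "map_mat rat_of_int (h \<cdot>\<^sub>m 1\<^sub>m s) = rat_of_int h \<cdot>\<^sub>m 1\<^sub>m s"
    by (intro eq_matI) auto
  have h0: "rat_of_int h \<noteq> 0" using h_pos by simp
  have unit: "(1 / rat_of_int h) \<cdot>\<^sub>m (rat_of_int h \<cdot>\<^sub>m 1\<^sub>m s) = (1\<^sub>m s :: rat mat)"
    using h0 by (intro eq_matI) auto
  have "?R * ?R' = rat_of_int h \<cdot>\<^sub>m 1\<^sub>m s"
    unfolding of_int_hom.mat_hom_mult[OF M_carrier M'_carrier, symmetric] M_M' one ..
  then have RB: "?R * ?B = 1\<^sub>m s"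
    unfolding mult_smult_distrib[OF R R'] using unit by simp
  have "?R' * ?R = rat_of_int h \<cdot>\<^sub>m 1\<^sub>m s"
    unfolding of_int_hom.mat_hom_mult[OF M'_carrier M_carrier, symmetric] M'_M one ..
  then have BR: "?B * ?R = 1\<^sub>m s"
    unfolding mult_smult_assoc_mat[OF R' R] using unit by simp
  have "?R \<in> Units (ring_mat TYPE(rat) s ())"
    unfolding Units_def ring_mat_def using R B RB BR by auto
  then obtain C where C: "mat_inverse ?R = Some C"
    using mat_inverse(1)[OF R, where b = "()"] by (cases "mat_inverse ?R") auto
  from mat_inverse(2)[OF R C] have C': "C * ?R = 1\<^sub>m s" "C \<in> carrier_mat s s" by auto
  have "C = C * (?R * ?B)" using C'(2) RB by simp
  also have "\<dots> = (C * ?R) * ?B" using assoc_mult_mat[OF C'(2) R B] by simp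
  also have "\<dots> = ?B" using C'(1) B by simp
  finally have "C = ?B" .
  then show ?thesis using C by (simp add: plumbing_inv_def)
qed

lemma leaf_pos:
  assumes "i \<in> legs"
  shows "0 < i" "i < s" "pos i (length (c i) - 1) = i" "length (c i) - 1 < length (c i)"
  using pos_range[OF assms, of "length (c i) - 1"] pos_leaf[OF assms] len_pos[OF assms] by simp_all

lemma leg_vec_leaf:
  "i \<in> legs \<Longrightarrow> leg_vec x f i = f i (length (c i) - 1)"
  by (metis leaf_pos(3,4) leg_vec_pos)

section \<open>The quadratic form on node and leaves\<close>

text \<open>The vectors to which an admissible family can assign a nonzero weight.\<close>

definition leaf_vec :: "int \<Rightarrow> (nat \<Rightarrow> int) \<Rightarrow> int vec" where
  "leaf_vec n e = vec s (\<lambda>v. if v = 0 then n else if v \<in> legs then e v else 0)"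

lemma leaf_vec_carrier [simp]: "leaf_vec n e \<in> carrier_vec s"
  by (simp add: leaf_vec_def)

lemma leaf_vec_0 [simp]: "leaf_vec n e $ 0 = n"
  using s_pos by (simp add: leaf_vec_def)

lemma leaf_vec_leaf [simp]: "i \<in> legs \<Longrightarrow> leaf_vec n e $ i = e i"
  using leaf_pos(1,2)[of i] by (simp add: leaf_vec_def)

text \<open>The hypothesis says that vertices at which the vector vanishes contribute nothing.\<close>

lemma sum_leaf_vec:
  assumes "\<And>v. g v 0 = 0"
  shows "(\<Sum>v<s. g v (leaf_vec n e $ v)) = g 0 n + (\<Sum>i\<in>legs. (g i (e i) :: 'b :: comm_monoid_add))"
proof -
  have "(\<Sum>v<s. g v (leaf_vec n e $ v)) = (\<Sum>v\<in>insert 0 legs. g v (leaf_vec n e $ v))"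
    using s_pos leaf_pos(2) assms by (intro sum.mono_neutral_right) (auto simp: leaf_vec_def)
  also have "\<dots> = g 0 n + (\<Sum>i\<in>legs. g i (e i))"
    using leaf_pos(1) by (subst sum.insert) auto
  finally show ?thesis .
qed

lemma leg_pos_leaf_iff:
  assumes "i \<in> legs" "p < length (c i)"
  shows "pos i p \<in> legs \<longleftrightarrow> Suc p = length (c i)"
proof
  assume j: "pos i p \<in> legs"
  have "pos i p = pos (pos i p) (length (c (pos i p)) - 1)" using leaf_pos(3)[OF j] by simp
  then have "i = pos i p \<and> p = length (c (pos i p)) - 1"
    using pos_eq_iff[OF assms j leaf_pos(4)[OF j]] by blast
  then show "Suc p = length (c i)" using len_pos[OF j] by (metis Suc_pred' diff_Suc_1)
next
  assume "Suc p = length (c i)"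
  then have "pos i p = i" using leaf_pos(3)[OF assms(1)] by (metis diff_Suc_1)
  then show "pos i p \<in> legs" using assms(1) by simp
qed

lemma M'_mult_leaf_vec:
  assumes "v < s"
  shows "(M' *\<^sub>v leaf_vec n e) $ v = n * M' $$ (v, 0) + (\<Sum>i\<in>legs. e i * M' $$ (v, i))"
proof -
  have "(M' *\<^sub>v leaf_vec n e) $ v = (\<Sum>w<s. M' $$ (v, w) * leaf_vec n e $ w)"
    using assms M'_carrier by (auto simp: scalar_prod_def atLeast0LessThan leaf_vec_def)
  then show ?thesis using sum_leaf_vec[of "\<lambda>w x. M' $$ (v, w) * x" n e]
    by (simp add: mult.commute)
qed

lemma M'_col_node:
  assumes "v < s"
  shows "M' $$ (v, 0) = node_fun v"
proof -
  have "vec s (leg_vec h (\<lambda>_ _. 0)) = leaf_vec h (\<lambda>_. 0)"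
    by (rule eq_vecI) (auto simp: leaf_vec_def node_delta)
  then have "M' *\<^sub>v leaf_vec h (\<lambda>_. 0) = h \<cdot>\<^sub>v vec s node_fun"
    using M'_M_vec[of "vec s node_fun"] by (simp add: M_node)
  from arg_cong[OF this, of "\<lambda>x. x $ v"] show ?thesis
    using assms h_pos M'_mult_leaf_vec[OF assms, of h "\<lambda>_. 0"] by simp
qed

text \<open>This is \<open>M'M = h\<close> applied to \<open>head_fun i\<close>, since \<open>M\<close> maps \<open>head_fun i\<close> to the difference of the
  unit vector of the node and \<open>a\<^sub>i\<close> times that of the leaf.\<close>

lemma M'_col_leaf:
  assumes "v < s" and i: "i \<in> legs"
  shows "M' $$ (v, 0) - a i * M' $$ (v, i) = h * head_fun i v"
proof -
  have "vec s (leg_vec 1 (\<lambda>j q. if j = i \<and> Suc q = length (c i) then - a i else 0)) =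
        leaf_vec 1 (\<lambda>j. if j = i then - a i else 0)" (is "?L = ?R")
  proof (rule eq_vecI)
    fix v assume "v < dim_vec ?R"
    then have "v < s" by (simp add: leaf_vec_def)
    then show "?L $ v = ?R $ v"
    proof (cases rule: vertex_cases)
      case node
      then show ?thesis using s_pos by simp
    next
      case (leg j q)
      have "Suc q = length (c j) \<Longrightarrow> pos j q = j"
        using leaf_pos(3)[OF leg(1)] by (metis diff_Suc_1)
      then show ?thesis
        using leg pos_range[OF leg(1,2)] leg_pos_leaf_iff[OF leg(1,2)]
        by (auto simp: leaf_vec_def)
    qed
  qed (simp add: leaf_vec_def)
  then have "M' *\<^sub>v leaf_vec 1 (\<lambda>j. if j = i then - a i else 0) = h \<cdot>\<^sub>v vec s (head_fun i)"
    using M'_M_vec[of "vec s (head_fun i)"] by (simp add: M_head[OF i])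
  from arg_cong[OF this, of "\<lambda>x. x $ v"]
  have "M' $$ (v, 0) + (\<Sum>j\<in>legs. (if j = i then - a i else 0) * M' $$ (v, j)) = h * head_fun i v"
    using assms M'_mult_leaf_vec[OF assms(1), of 1 "\<lambda>j. if j = i then - a i else 0"] by simp
  moreover have "(\<Sum>j\<in>legs. (if j = i then - a i else 0) * M' $$ (v, j)) =
     (\<Sum>j\<in>legs. if j = i then - a i * M' $$ (v, j) else 0)" by (rule sum.cong) auto
  ultimately show ?thesis using i by (simp add: sum.delta)
qed

lemma M'_entries:
  shows "M' $$ (0, 0) = - A"
    and "i \<in> legs \<Longrightarrow> M' $$ (i, 0) = - abar i"
    and "i \<in> legs \<Longrightarrow> a i * M' $$ (0, i) = - A"
    and "i \<in> legs \<Longrightarrow> j \<in> legs \<Longrightarrow> i \<noteq> j \<Longrightarrow> a i * M' $$ (j, i) = - abar j"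
proof -
  show node: "M' $$ (0, 0) = - A" using M'_col_node[OF s_pos] by (simp add: node_fun_def)
  show col: "M' $$ (i, 0) = - abar i" if "i \<in> legs" for i
    using M'_col_node[OF leaf_pos(2)[OF that]] len_pos[OF that]
    by (simp add: node_fun_def leg_vec_leaf[OF that])
  show "a i * M' $$ (0, i) = - A" if "i \<in> legs"
    using M'_col_leaf[OF s_pos that] node by (simp add: head_fun_def)
  show "a i * M' $$ (j, i) = - abar j" if "i \<in> legs" "j \<in> legs" "i \<noteq> j"
    using M'_col_leaf[OF leaf_pos(2)[OF that(2)] that(1)] col[OF that(2)] that
    by (simp add: head_fun_def leg_vec_leaf)
qed

text \<open>The entries of \<open>M'\<close> at node and leaves are those of a form of rank one, \<open>-A\<close> times the square of
  \<open>n + \<Sum>\<^sub>i e\<^sub>i/a\<^sub>i\<close>, except on the diagonal at the leaves.\<close>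

lemma quadratic_form_leaf_vec:
  "rat_of_int (leaf_vec n e \<bullet> (M' *\<^sub>v leaf_vec n e)) =
     - rat_of_int A * (rat_of_int n + (\<Sum>i\<in>legs. rat_of_int (e i) / rat_of_int (a i)))\<^sup>2 +
     (\<Sum>i\<in>legs. (rat_of_int (e i))\<^sup>2 *
        (rat_of_int (M' $$ (i, i)) + rat_of_int A / (rat_of_int (a i))\<^sup>2))"
proof -
  define r where "r = rat_of_int"
  define m where "m i = 1 / r (a i)" for i
  have a0: "r (a i) \<noteq> 0" if "i \<in> legs" for i using a_pos[OF that] by (simp add: r_def)
  have e00: "r (M' $$ (0, 0)) = - r A" by (simp add: M'_entries r_def)
  have abar: "r (abar i) = r A * m i" if "i \<in> legs" for i
    using a_abar[OF that] a0[OF that] by (simp add: m_def r_def field_simps flip: of_int_mult)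
  have ei0: "r (M' $$ (i, 0)) = - r A * m i" if "i \<in> legs" for i
    using M'_entries(2)[OF that] abar[OF that] by (simp add: r_def)
  have e0i: "r (M' $$ (0, i)) = - r A * m i" if "i \<in> legs" for i
  proof -
    have "r (a i) * r (M' $$ (0, i)) = - r A"
      using M'_entries(3)[OF that] by (simp add: r_def flip: of_int_mult)
    then show ?thesis using a0[OF that] by (simp add: m_def field_simps)
  qed
  have eij: "r (M' $$ (j, i)) = - r A * m j * m i" if "i \<in> legs" "j \<in> legs" "i \<noteq> j" for i j
  proof -
    have "r (a i) * r (M' $$ (j, i)) = - r (abar j)"
      using M'_entries(4)[OF that] by (simp add: r_def flip: of_int_mult)
    then have "r (M' $$ (j, i)) = - r (abar j) / r (a i)"
      using a0[OF that(1)] by (simp add: field_simps)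
    then show ?thesis using abar[OF that(2)] by (simp add: m_def)
  qed
  have "leaf_vec n e \<bullet> (M' *\<^sub>v leaf_vec n e) =
    (\<Sum>v<s. leaf_vec n e $ v * (M' *\<^sub>v leaf_vec n e) $ v)"
    using M'_carrier by (auto simp: scalar_prod_def atLeast0LessThan)
  also have "\<dots> = n * (M' *\<^sub>v leaf_vec n e) $ 0 + (\<Sum>j\<in>legs. e j * (M' *\<^sub>v leaf_vec n e) $ j)"
    using sum_leaf_vec[of "\<lambda>v x. x * (M' *\<^sub>v leaf_vec n e) $ v" n e] by simp
  finally have "leaf_vec n e \<bullet> (M' *\<^sub>v leaf_vec n e) = n * (M' *\<^sub>v leaf_vec n e) $ 0 +
    (\<Sum>j\<in>legs. e j * (M' *\<^sub>v leaf_vec n e) $ j)" .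
  also have "\<dots> = n * (n * M' $$ (0, 0) + (\<Sum>i\<in>legs. e i * M' $$ (0, i))) +
     (\<Sum>j\<in>legs. e j * (n * M' $$ (j, 0) + (\<Sum>i\<in>legs. e i * M' $$ (j, i))))"
    using M'_mult_leaf_vec s_pos leaf_pos(2) by simp
  finally have form: "r (leaf_vec n e \<bullet> (M' *\<^sub>v leaf_vec n e)) =
     r n * (r n * r (M' $$ (0, 0)) + (\<Sum>i\<in>legs. r (e i) * r (M' $$ (0, i)))) +
     (\<Sum>j\<in>legs. r (e j) * (r n * r (M' $$ (j, 0)) + (\<Sum>i\<in>legs. r (e i) * r (M' $$ (j, i)))))"
    by (simp add: r_def)
  have l: "1 \<in> legs" "2 \<in> legs" "3 \<in> legs" by (simp_all add: legs_def)
  have dv: "r (e i) / r (a i) = r (e i) * m i" "r A / (r (a i))\<^sup>2 = r A * (m i)\<^sup>2" for i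
    by (simp_all add: m_def power2_eq_square)
  show ?thesis
    unfolding r_def[symmetric] form dv sum_legs e00 ei0[OF l(1)] ei0[OF l(2)] ei0[OF l(3)]
      e0i[OF l(1)] e0i[OF l(2)] e0i[OF l(3)]
    using eij[OF l(1,2)] eij[OF l(1,3)] eij[OF l(2,3)] eij[OF l(2,1)] eij[OF l(3,1)] eij[OF l(3,2)]
    by (simp add: power2_eq_square algebra_simps)
qed

end

section \<open>Uniqueness of Laurent coefficients\<close>

lemma has_sum_finite_sum:
  fixes f :: "'i \<Rightarrow> 'a \<Rightarrow> 'b :: topological_comm_monoid_add"
  assumes "finite J" "\<And>j. j \<in> J \<Longrightarrow> (f j has_sum x j) X"
  shows "((\<lambda>y. \<Sum>j\<in>J. f j y) has_sum (\<Sum>j\<in>J. x j)) X"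
  using assms
proof (induction J rule: finite_induct)
  case (insert k J)
  then show ?case by (simp add: has_sum_add)
qed simp

text \<open>Averaging over the \<open>m\<close>-th roots of unity keeps the exponent \<open>0\<close> and removes all other exponents of
  absolute value less than \<open>m\<close>.\<close>

lemma roots_of_unity_sum:
  fixes k :: int
  assumes m: "m > 0"
  defines "\<omega> \<equiv> \<lambda>j::nat. cis (2 * pi * real j / real m)"
  shows "norm (\<Sum>j<m. \<omega> j powi k) \<le> real m"
    and "k = 0 \<Longrightarrow> (\<Sum>j<m. \<omega> j powi k) = of_nat m"
    and "k \<noteq> 0 \<Longrightarrow> \<bar>k\<bar> < int m \<Longrightarrow> (\<Sum>j<m. \<omega> j powi k) = 0"
proof -
  have "norm (\<Sum>j<m. \<omega> j powi k) \<le> (\<Sum>j<m. 1)"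
    by (rule sum_norm_le) (simp add: \<omega>_def norm_power_int)
  then show "norm (\<Sum>j<m. \<omega> j powi k) \<le> real m" by simp
  show "(\<Sum>j<m. \<omega> j powi k) = of_nat m" if "k = 0" using that by simp
  show "(\<Sum>j<m. \<omega> j powi k) = 0" if k: "k \<noteq> 0" "\<bar>k\<bar> < int m"
  proof -
    \<comment> \<open>The sum is a geometric one with ratio \<open>z\<close>, an \<open>m\<close>-th root of unity other than \<open>1\<close>.\<close>
    define z where "z = cis (2 * pi * of_int k / real m)"
    have pow: "\<omega> j powi k = z ^ j" for j
      by (simp add: \<omega>_def z_def cis_power_int DeMoivre field_simps)
    have zm: "z ^ m = 1"
    proof -
      have "z ^ m = cis (2 * pi * of_int k)" using m by (simp add: z_def DeMoivre)
      then show ?thesis by (simp add: cis_multiple_2pi)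
    qed
    have z1: "z \<noteq> 1"
    proof
      assume "z = 1"
      then have "cos (2 * pi * of_int k / real m) = 1" by (metis Re_complex_of_real cis.simps(1) of_real_1 z_def)
      then obtain i :: int where "2 * pi * of_int k / real m = of_int i * 2 * pi"
        by (auto simp: cos_one_2pi_int)
      then have "real_of_int k = real_of_int (i * int m)" using m by (simp add: field_simps)
      then have "k = i * int m" by (simp only: of_int_eq_iff)
      then show False using k by (metis abs_mult abs_of_nat dvd_triv_right dvd_imp_le_int not_less)
    qed
    have "(\<Sum>j<m. \<omega> j powi k) = (\<Sum>j<m. z ^ j)" by (simp add: pow)
    also have "\<dots> = 0" using geometric_sum[OF z1, of m] zm by simp
    finally show ?thesis .
  qed
qed

text \<open>Multiply the series by \<open>u\<^bsup>-n\<^sub>0\<^esup>\<close> and average over the \<open>m\<close>-th roots of unity. For large \<open>m\<close> what remains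
  is the coefficient at \<open>n\<^sub>0\<close> and a part of the tail of an absolutely convergent series, which is too small to
  cancel it.\<close>

lemma circle_series_unique:
  fixes f :: "int \<Rightarrow> complex"
  assumes zero: "\<And>u. norm u = 1 \<Longrightarrow> ((\<lambda>n. f n * u powi n) has_sum 0) UNIV"
  shows "f n0 = 0"
proof (rule ccontr)
  assume "f n0 \<noteq> 0"
  define \<epsilon> where "\<epsilon> = norm (f n0)"
  have \<epsilon>: "\<epsilon> > 0" using \<open>f n0 \<noteq> 0\<close> by (simp add: \<epsilon>_def)
  have "f summable_on UNIV" using has_sum_imp_summable[OF zero[of 1]] by simp
  then have abs: "(\<lambda>n. norm (f n)) summable_on UNIV"
    by (simp add: summable_on_iff_abs_summable_on_complex)
  \<comment> \<open>Outside the finite set \<open>X0\<close> the absolute values of the coefficients sum to at most half of the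
    coefficient in question.\<close>
  obtain X0 where X0: "finite X0" "dist (sum (\<lambda>n. norm (f n)) X0) (infsum (\<lambda>n. norm (f n)) UNIV) \<le> \<epsilon> / 2"
    using infsum_finite_approximation[OF abs, of "\<epsilon> / 2"] \<epsilon> by auto
  define X where "X = insert n0 X0"
  have X: "finite X" "n0 \<in> X" using X0 by (simp_all add: X_def)
  have absX: "(\<lambda>n. norm (f n)) summable_on (- X)"
    using summable_on_subset_banach[OF abs] by simp
  have "infsum (\<lambda>n. norm (f n)) UNIV = infsum (\<lambda>n. norm (f n)) (X \<union> - X)" by simp
  also have "\<dots> = sum (\<lambda>n. norm (f n)) X + infsum (\<lambda>n. norm (f n)) (- X)"
    using X absX by (subst infsum_Un_disjoint) auto
  finally have "infsum (\<lambda>n. norm (f n)) (- X) =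
     infsum (\<lambda>n. norm (f n)) UNIV - sum (\<lambda>n. norm (f n)) X" by simp
  also have "\<dots> \<le> infsum (\<lambda>n. norm (f n)) UNIV - sum (\<lambda>n. norm (f n)) X0"
    using X0(1) by (intro diff_left_mono sum_mono2) (auto simp: X_def)
  also have "\<dots> \<le> \<epsilon> / 2" using X0(2) unfolding dist_real_def by linarith
  finally have tail: "infsum (\<lambda>n. norm (f n)) (- X) \<le> \<epsilon> / 2" .
  \<comment> \<open>The number \<open>m\<close> exceeds all differences \<open>n - n0\<close> with \<open>n \<in> X\<close>, so that averaging removes all
    of \<open>X\<close> except \<open>n0\<close>.\<close>
  obtain m :: nat where m: "m > 0" "\<And>n. n \<in> X \<Longrightarrow> \<bar>n - n0\<bar> < int m"
  proof
    let ?m = "Suc (nat (Max ((\<lambda>n. \<bar>n - n0\<bar>) ` X)))"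
    show "?m > 0" by simp
    fix n assume "n \<in> X"
    then have "\<bar>n - n0\<bar> \<le> Max ((\<lambda>n. \<bar>n - n0\<bar>) ` X)" using X by simp
    then show "\<bar>n - n0\<bar> < int ?m" by linarith
  qed
  define \<omega> where "\<omega> j = cis (2 * pi * real j / real m)" for j :: nat
  define S where "S k = (\<Sum>j<m. \<omega> j powi k)" for k
  note S = roots_of_unity_sum[OF m(1), folded \<omega>_def, folded S_def]
  have \<omega>: "\<omega> j \<noteq> 0" "norm (\<omega> j) = 1" for j by (simp_all add: \<omega>_def)
  define g where "g n = f n * S (n - n0)" for n
  have "((\<lambda>n. \<Sum>j<m. \<omega> j powi (- n0) * (f n * \<omega> j powi n)) has_sum (\<Sum>j<m. \<omega> j powi (- n0) * 0)) UNIV"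
    by (intro has_sum_finite_sum has_sum_cmult_right zero \<omega>) simp
  moreover have "(\<Sum>j<m. \<omega> j powi (- n0) * (f n * \<omega> j powi n)) = g n" for n
    using \<omega> by (simp add: g_def S_def sum_distrib_left power_int_diff power_int_minus field_simps)
  ultimately have g0: "(g has_sum 0) UNIV" by simp
  then have gabs: "(\<lambda>n. norm (g n)) summable_on UNIV"
    using has_sum_imp_summable summable_on_iff_abs_summable_on_complex by blast
  have gX: "g summable_on (- X)" "(\<lambda>n. norm (g n)) summable_on (- X)"
    using summable_on_subset_banach[OF has_sum_imp_summable[OF g0]]
      summable_on_subset_banach[OF gabs] by simp_all
  have "0 = infsum g (X \<union> - X)" using infsumI[OF g0] by simp
  also have "\<dots> = sum g X + infsum g (- X)"
    using X gX by (subst infsum_Un_disjoint) auto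
  also have "sum g X = (\<Sum>n\<in>X. if n = n0 then of_nat m * f n0 else 0)"
    using S m(2) by (intro sum.cong) (auto simp: g_def)
  also have "\<dots> = of_nat m * f n0" using X by (simp add: sum.delta)
  finally have "of_nat m * f n0 = - infsum g (- X)" by (simp add: eq_neg_iff_add_eq_0)
  then have "real m * \<epsilon> = norm (infsum g (- X))"
    by (metis \<epsilon>_def norm_minus_cancel norm_mult norm_of_nat)
  also have "\<dots> \<le> infsum (\<lambda>n. norm (g n)) (- X)" by (rule norm_infsum_bound[OF gX(2)])
  also have "\<dots> \<le> infsum (\<lambda>n. real m * norm (f n)) (- X)"
  proof (rule infsum_mono[OF gX(2)])
    show "(\<lambda>n. real m * norm (f n)) summable_on - X" by (rule summable_on_cmult_right[OF absX])
    show "norm (g n) \<le> real m * norm (f n)" for n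
      using mult_left_mono[OF S(1), of "norm (f n)" "n - n0"]
      by (simp add: g_def norm_mult mult.commute)
  qed
  also have "\<dots> = real m * infsum (\<lambda>n. norm (f n)) (- X)" by (rule infsum_cmult_right')
  also have "\<dots> \<le> real m * (\<epsilon> / 2)" using tail by (intro mult_left_mono) simp_all
  finally show False using m(1) \<epsilon> by simp
qed

text \<open>Summing over \<open>r\<close> first reduces this to series in \<open>u\<close> and then to series in \<open>v\<close>.\<close>

lemma torus_series_unique:
  fixes d :: "int \<times> int \<Rightarrow> complex"
  assumes zero: "\<And>u v. norm u = 1 \<Longrightarrow> norm v = 1 \<Longrightarrow>
      ((\<lambda>(n, r). d (n, r) * u powi n * v powi r) has_sum 0) UNIV"
  shows "d (n, r) = 0"
proof -
  have row: "(\<lambda>r. d (n, r) * v powi r) summable_on UNIV" if v: "norm v = 1" for n v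
  proof -
    have "(\<lambda>(n, r). d (n, r) * 1 powi n * v powi r) summable_on UNIV"
      by (rule has_sum_imp_summable[OF zero]) (simp_all add: v)
    then have "(\<lambda>(n, r). d (n, r) * 1 powi n * v powi r) summable_on (range (Pair n))"
      by (rule summable_on_subset_banach) simp
    then show ?thesis
      by (subst (asm) summable_on_reindex) (auto simp: inj_on_def o_def)
  qed
  have "((\<lambda>r. d (n, r) * v powi r) has_sum 0) UNIV" if v: "norm v = 1" for n v
  proof -
    have "infsum (\<lambda>r. d (n, r) * v powi r) UNIV = 0"
    proof (rule circle_series_unique[where f = "\<lambda>n. infsum (\<lambda>r. d (n, r) * v powi r) UNIV"])
      fix u :: complex assume u: "norm u = 1"
      show "((\<lambda>n. infsum (\<lambda>r. d (n, r) * v powi r) UNIV * u powi n) has_sum 0) UNIV"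
      proof (rule has_sum_Sigma'[where f = "\<lambda>(n, r). d (n, r) * u powi n * v powi r"
            and A = UNIV and B = "\<lambda>_. UNIV"])
        show "((\<lambda>(n, r). d (n, r) * u powi n * v powi r) has_sum 0) (UNIV \<times> UNIV)"
          using zero[OF u v] by simp
        fix n :: int
        have "((\<lambda>r. u powi n * (d (n, r) * v powi r)) has_sum
              u powi n * infsum (\<lambda>r. d (n, r) * v powi r) UNIV) UNIV"
          by (intro has_sum_cmult_right has_sum_infsum row v)
        then show "((\<lambda>r. case (n, r) of (n, r) \<Rightarrow> d (n, r) * u powi n * v powi r) has_sum
              infsum (\<lambda>r. d (n, r) * v powi r) UNIV * u powi n) UNIV"
          by (simp add: mult_ac)
      qed
    qed
    then show ?thesis using has_sum_infsum[OF row[OF v, of n]] by simp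
  qed
  then show ?thesis by (rule circle_series_unique[where f = "\<lambda>r. d (n, r)"])
qed

text \<open>A Laurent expansion is determined by its values on a single torus inside the region.\<close>

lemma laurent_expansion_eqI:
  assumes base: "(t0, z0) \<in> D" "t0 \<noteq> 0" "z0 \<noteq> 0"
    and rot: "\<And>u v. norm u = 1 \<Longrightarrow> norm v = 1 \<Longrightarrow> (v * t0, u * z0) \<in> D"
    and sum: "\<And>t z. (t, z) \<in> D \<Longrightarrow>
      ((\<lambda>(n, r). complex_of_real (c (n, r)) * z powi n * t powi r) has_sum f t z) UNIV"
  shows "laurent_expansion D f = c"
  unfolding laurent_expansion_def
proof (rule the_equality)
  show "\<forall>(t, z)\<in>D. ((\<lambda>(n, r). complex_of_real (c (n, r)) * z powi n * t powi r) has_sum f t z) UNIV"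
    using sum by auto
next
  fix c' assume c': "\<forall>(t, z)\<in>D.
    ((\<lambda>(n, r). complex_of_real (c' (n, r)) * z powi n * t powi r) has_sum f t z) UNIV"
  have "complex_of_real (c' (n, r) - c (n, r)) * z0 powi n * t0 powi r = 0" for n r
  proof (rule torus_series_unique[where d = "\<lambda>(n, r). complex_of_real (c' (n, r) - c (n, r)) * z0 powi n * t0 powi r",
        simplified case_prod_conv])
    fix u v :: complex assume uv: "norm u = 1" "norm v = 1"
    let ?t = "v * t0" and ?z = "u * z0"
    have "((\<lambda>p. (case p of (n, r) \<Rightarrow> complex_of_real (c' (n, r)) * ?z powi n * ?t powi r) +
             - (case p of (n, r) \<Rightarrow> complex_of_real (c (n, r)) * ?z powi n * ?t powi r))
          has_sum (f ?t ?z + - f ?t ?z)) UNIV"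
      using sum[OF rot[OF uv]] c' rot[OF uv] by (intro has_sum_add has_sum_uminusI) auto
    then show "((\<lambda>(n, r). complex_of_real (c' (n, r) - c (n, r)) * z0 powi n * t0 powi r *
        u powi n * v powi r) has_sum 0) UNIV"
      by (simp add: case_prod_unfold power_int_mult_distrib algebra_simps)
  qed
  then show "c' = c" using base by (auto simp: fun_eq_iff)
qed

section \<open>Collecting the terms of a series by exponents\<close>

text \<open>The expansion of \<open>f\<^sub>0\<close> arises as a series indexed by pairs \<open>(n, e)\<close>, several of which can have the same
  exponents. Here \<open>\<phi>\<close> is the map to the exponents.\<close>

lemma has_sum_collect:
  fixes g :: "'a \<Rightarrow> 'c :: {comm_monoid_add, uniform_space, uniform_topological_group_add}"
  assumes sum: "(g has_sum S) X" and fin: "\<And>p. finite {x \<in> X. \<phi> x = p}"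
  shows "((\<lambda>p. \<Sum>x\<in>{x \<in> X. \<phi> x = p}. g x) has_sum S) UNIV"
proof (rule has_sum_Sigma')
  have "bij_betw (\<lambda>x. (\<phi> x, x)) X (SIGMA p:UNIV. {x \<in> X. \<phi> x = p})"
    by (auto simp: bij_betw_def inj_on_def)
  from has_sum_reindex_bij_betw[OF this, of "\<lambda>(p, x). g x" S]
  show "((\<lambda>(p, x). g x) has_sum S) (SIGMA p:UNIV. {x \<in> X. \<phi> x = p})" using sum by simp
qed (simp add: has_sum_finite fin)

lemma has_sum_times_finite:
  fixes g :: "'a \<Rightarrow> 'c :: {topological_semigroup_mult, semiring_0, topological_comm_monoid_add}"
  assumes g: "(g has_sum S) N" and "finite E"
  shows "((\<lambda>(n, e). h e * g n) has_sum (\<Sum>e\<in>E. h e) * S) (N \<times> E)"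
  using assms(2)
proof (induction E rule: finite_induct)
  case (insert e E)
  have "((\<lambda>(n, e). h e * g n) has_sum h e * S) ((\<lambda>n. (n, e)) ` N)"
    by (subst has_sum_reindex) (auto simp: inj_on_def o_def intro!: has_sum_cmult_right g)
  from has_sum_Un_disjoint[OF this insert.IH]
  have "((\<lambda>(n, e). h e * g n) has_sum h e * S + (\<Sum>e\<in>E. h e) * S)
      ((\<lambda>n. (n, e)) ` N \<union> N \<times> E)" using insert.hyps by auto
  moreover have "(\<lambda>n. (n, e)) ` N \<union> N \<times> E = N \<times> insert e E" by auto
  ultimately show ?case using insert.hyps by (simp add: algebra_simps)
qed simp

section \<open>The expansions of the rational function\<close>

text \<open>The signs are extensional functions on \<open>legs\<close>, so that a product over the legs of sums over two signs
  expands into a sum over this set.\<close>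

definition signs :: "(nat \<Rightarrow> int) set" where
  "signs = legs \<rightarrow>\<^sub>E {- 1, 1}"

lemma finite_signs [simp]: "finite signs"
  unfolding signs_def by (rule finite_PiE) auto

definition sign_prod :: "(nat \<Rightarrow> int) \<Rightarrow> int" where
  "sign_prod e = (\<Prod>i\<in>legs. e i)"

text \<open>The sign is chosen so that the index \<open>(n, e)\<close> here belongs to the vector \<open>leaf_vec n e\<close> of the invariant
  with the same power of \<open>t\<close>; the Laplace transform does not see the sign of the exponent of \<open>z\<close>.\<close>

definition z_exp :: "(nat \<Rightarrow> int) \<Rightarrow> int \<Rightarrow> (nat \<Rightarrow> int) \<Rightarrow> int" where
  "z_exp a n e = - (prod_a a * n + (\<Sum>i\<in>legs. e i * (prod_a a div a i)))"

definition t_exp :: "int \<Rightarrow> (nat \<Rightarrow> int) \<Rightarrow> int" where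
  "t_exp n e = n + (\<Sum>i\<in>legs. e i)"

text \<open>The power of \<open>t\<close> and the signs determine \<open>n\<close>.\<close>

lemma finite_t_exp_fibre: "finite {x \<in> N \<times> signs. t_exp (fst x) (snd x) = r}"
proof (rule finite_subset)
  show "{x \<in> N \<times> signs. t_exp (fst x) (snd x) = r} \<subseteq>
        (\<lambda>e. (r - (\<Sum>i\<in>legs. e i), e)) ` signs"
    by (auto simp: t_exp_def)
qed simp

text \<open>Expanding the product over the legs into a sum over the signs; reversing all three differences gives
  the sign in front.\<close>

lemma sum_signs_factor:
  fixes t z :: complex
  assumes "t \<noteq> 0" "z \<noteq> 0"
  shows "(\<Sum>e\<in>signs. of_int (sign_prod e) * (z powi (- (\<Sum>i\<in>legs. e i * m i)) * t powi (\<Sum>i\<in>legs. e i))) =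
     - (\<Prod>i\<in>legs. z powi m i * inverse t - z powi (- m i) * t)"
proof -
  have "(\<Sum>e\<in>signs. of_int (sign_prod e) * (z powi (- (\<Sum>i\<in>legs. e i * m i)) * t powi (\<Sum>i\<in>legs. e i))) =
     (\<Sum>e\<in>signs. \<Prod>i\<in>legs. of_int (e i) * (z powi (- (e i * m i)) * t powi e i))"
    using assms
    by (intro sum.cong refl)
      (simp add: sign_prod_def prod_legs sum_legs power_int_add power_int_diff power_int_minus
        divide_inverse mult_ac)
  also have "\<dots> = (\<Prod>i\<in>legs. \<Sum>y\<in>{- 1, 1}. of_int y * (z powi (- (y * m i)) * t powi y))"
    unfolding signs_def by (rule prod_sum_PiE[symmetric]) auto
  also have "\<dots> = (\<Prod>i\<in>legs. - (z powi m i * inverse t - z powi (- m i) * t))"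
    by (intro prod.cong refl) (simp add: power_int_minus)
  also have "\<dots> = - (\<Prod>i\<in>legs. z powi m i * inverse t - z powi (- m i) * t)"
    unfolding prod_uminus card_legs by simp
  finally show ?thesis .
qed

lemma has_sum_odd_geometric:
  fixes y :: complex
  assumes y: "y \<noteq> 0" "norm y < 1"
  shows "((\<lambda>n. y powi n) has_sum 1 / (inverse y - y)) {n :: int. odd n \<and> n > 0}"
proof -
  have ny: "norm (y\<^sup>2) < 1" using y by (simp add: norm_power power_less_one_iff)
  have "summable (\<lambda>k. norm ((y\<^sup>2) ^ k))"
    unfolding norm_power by (rule summable_geometric) (use ny in \<open>simp add: norm_power\<close>)
  then have "((\<lambda>k. (y\<^sup>2) ^ k) has_sum 1 / (1 - y\<^sup>2)) UNIV"
    by (rule norm_summable_imp_has_sum) (rule geometric_sums[OF ny])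
  then have "((\<lambda>k. y * (y\<^sup>2) ^ k) has_sum y * (1 / (1 - y\<^sup>2))) UNIV"
    by (rule has_sum_cmult_right)
  moreover have "y * (y\<^sup>2) ^ k = y powi (2 * int k + 1)" for k
  proof -
    have "2 * int k + 1 = int (Suc (2 * k))" by simp
    then have "y powi (2 * int k + 1) = y ^ Suc (2 * k)" by (metis power_int_of_nat)
    then show ?thesis by (simp add: power_mult)
  qed
  moreover have "y * (1 / (1 - y\<^sup>2)) = 1 / (inverse y - y)"
    using y(1) by (simp add: divide_simps power2_eq_square)
  ultimately have "((\<lambda>k. y powi (2 * int k + 1)) has_sum 1 / (inverse y - y)) UNIV" by simp
  moreover have "bij_betw (\<lambda>k::nat. 2 * int k + 1) UNIV {n :: int. odd n \<and> n > 0}"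
  proof (rule bij_betw_byWitness[where f' = "\<lambda>n. nat (n div 2)"])
    show "\<forall>n\<in>{n :: int. odd n \<and> n > 0}. 2 * int (nat (n div 2)) + 1 = n"
      by (auto elim!: oddE)
  qed auto
  ultimately show ?thesis
    using has_sum_reindex_bij_betw[of "\<lambda>k::nat. 2 * int k + 1" UNIV _ "\<lambda>n. y powi n"] by blast
qed

lemma has_sum_odd_geometric_neg:
  fixes y :: complex
  assumes y: "norm y > 1"
  shows "((\<lambda>n. y powi n) has_sum 1 / (y - inverse y)) {n :: int. odd n \<and> n < 0}"
proof -
  have "inverse y \<noteq> 0" "norm (inverse y) < 1"
    using y by (auto simp: norm_inverse inverse_less_1_iff)
  from has_sum_odd_geometric[OF this]
  have "((\<lambda>n. inverse y powi n) has_sum 1 / (y - inverse y)) {n :: int. odd n \<and> n > 0}" by simp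
  moreover have "bij_betw uminus {n :: int. odd n \<and> n < 0} {n :: int. odd n \<and> n > 0}"
    by (rule bij_betw_byWitness[where f' = uminus]) auto
  ultimately have "((\<lambda>n. inverse y powi (- n)) has_sum 1 / (y - inverse y)) {n :: int. odd n \<and> n < 0}"
    using has_sum_reindex_bij_betw[of uminus _ _ "\<lambda>n. inverse y powi n"] by blast
  then show ?thesis by (simp add: power_int_minus power_int_inverse)
qed

text \<open>The coefficients of \<open>\<Sum> w n e * z\<^bsup>z_exp a n e\<^esup> * t\<^bsup>t_exp n e\<^esup>\<close>, summed over \<open>n \<in> N\<close> and all signs \<open>e\<close>.\<close>

definition collected :: "(nat \<Rightarrow> int) \<Rightarrow> int set \<Rightarrow> (int \<Rightarrow> (nat \<Rightarrow> int) \<Rightarrow> real) \<Rightarrow> zt_series" where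
  "collected a N w = (\<lambda>p. \<Sum>(n, e)\<in>{x \<in> N \<times> signs. (z_exp a (fst x) (snd x), t_exp (fst x) (snd x)) = p}. w n e)"

lemma finite_exp_fibre:
  "finite {x \<in> N \<times> signs. (z_exp a (fst x) (snd x), t_exp (fst x) (snd x)) = p}"
  by (rule finite_subset[OF _ finite_t_exp_fibre[of N "snd p"]]) auto

text \<open>With \<open>y = z\<^sup>-\<^sup>At\<close>, a summand with index \<open>(n, e)\<close> is \<open>y\<^sup>n\<close> times a term of the finite sum over the signs.
  The factor \<open>\<sigma>\<close> is the sign with which the geometric series in \<open>y\<close> enters.\<close>

lemma has_sum_collected:
  fixes t z :: complex and \<sigma> :: real
  assumes tz: "t \<noteq> 0" "z \<noteq> 0"
    and sum: "((\<lambda>n. (z powi (- prod_a a) * t) powi n) has_sum S) N"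
  shows "((\<lambda>(n, r). complex_of_real (collected a N (\<lambda>n e. \<sigma> * of_int (sign_prod e)) (n, r)) * z powi n * t powi r)
     has_sum - of_real \<sigma> * (\<Prod>i\<in>legs. z powi (prod_a a div a i) * inverse t - z powi (- (prod_a a div a i)) * t) * S) UNIV"
proof -
  define m where "m i = prod_a a div a i" for i
  define hh where "hh e = of_real \<sigma> * (of_int (sign_prod e) *
     (z powi (- (\<Sum>i\<in>legs. e i * m i)) * t powi (\<Sum>i\<in>legs. e i)))" for e
  define trm where "trm x = of_real \<sigma> * of_int (sign_prod (snd x)) *
     z powi z_exp a (fst x) (snd x) * t powi t_exp (fst x) (snd x)" for x :: "int \<times> (nat \<Rightarrow> int)"
  have "((\<lambda>(n, e). hh e * (z powi (- prod_a a) * t) powi n) has_sum (\<Sum>e\<in>signs. hh e) * S) (N \<times> signs)"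
    by (rule has_sum_times_finite[OF sum finite_signs])
  also have "(\<lambda>(n, e). hh e * (z powi (- prod_a a) * t) powi n) = trm"
  proof
    fix x :: "int \<times> (nat \<Rightarrow> int)"
    obtain n e where x: "x = (n, e)" by (cases x)
    have "z_exp a n e = (- prod_a a) * n + (- (\<Sum>i\<in>legs. e i * m i))"
      by (simp add: z_exp_def m_def)
    then have "z powi z_exp a n e = (z powi (- prod_a a)) powi n * z powi (- (\<Sum>i\<in>legs. e i * m i))"
      by (simp only: power_int_add[OF disjI1[OF tz(2)]] power_int_mult)
    moreover have "t powi t_exp n e = t powi n * t powi (\<Sum>i\<in>legs. e i)"
      using tz by (simp add: t_exp_def power_int_add)
    ultimately show "(case x of (n, e) \<Rightarrow> hh e * (z powi (- prod_a a) * t) powi n) = trm x"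
      by (simp add: x hh_def trm_def power_int_mult_distrib mult_ac)
  qed
  finally have "((\<lambda>p. \<Sum>x\<in>{x \<in> N \<times> signs. (z_exp a (fst x) (snd x), t_exp (fst x) (snd x)) = p}. trm x)
     has_sum (\<Sum>e\<in>signs. hh e) * S) UNIV"
    by (rule has_sum_collect[OF _ finite_exp_fibre])
  moreover have "(\<Sum>x\<in>{x \<in> N \<times> signs. (z_exp a (fst x) (snd x), t_exp (fst x) (snd x)) = p}. trm x) =
     (case p of (n, r) \<Rightarrow> complex_of_real (collected a N (\<lambda>n e. \<sigma> * of_int (sign_prod e)) (n, r)) * z powi n * t powi r)" for p
  proof -
    obtain n r where p: "p = (n, r)" by (cases p)
    show ?thesis
      unfolding p collected_def case_prod_conv of_real_sum sum_distrib_right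
      by (rule sum.cong) (auto simp: trm_def)
  qed
  moreover have "(\<Sum>e\<in>signs. hh e) = - of_real \<sigma> *
      (\<Prod>i\<in>legs. z powi m i * inverse t - z powi (- m i) * t)"
    unfolding hh_def sum_distrib_left[symmetric] sum_signs_factor[OF tz] by simp
  ultimately show ?thesis by (simp add: m_def)
qed

lemma f0_legs: "f0 a t z =
     (\<Prod>i\<in>legs. z powi (prod_a a div a i) * inverse t - z powi (- (prod_a a div a i)) * t) /
     (z powi (prod_a a) * inverse t - z powi (- prod_a a) * t)"
  by (simp add: f0_def legs_def)

text \<open>The region \<open>\<bar>z\<^sup>At\<^sup>-\<^sup>1\<bar> < 1\<close> is \<open>\<bar>y\<bar> > 1\<close> for \<open>y = z\<^sup>-\<^sup>At\<close>, where \<open>1/(y - y\<^sup>-\<^sup>1)\<close> is a series in negative odd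
  powers of \<open>y\<close>.\<close>

lemma laurent_expansion_zero:
  "laurent_expansion {(t, z). t \<noteq> 0 \<and> z \<noteq> 0 \<and> norm (z powi prod_a a * inverse t) < 1} (f0 a) =
   collected a {n. odd n \<and> n < 0} (\<lambda>n e. 1 * of_int (sign_prod e))"
proof (rule laurent_expansion_eqI[where ?t0.0 = 2 and ?z0.0 = 1])
  fix t z :: complex
  assume "(t, z) \<in> {(t, z). t \<noteq> 0 \<and> z \<noteq> 0 \<and> norm (z powi prod_a a * inverse t) < 1}"
  then have tz: "t \<noteq> 0" "z \<noteq> 0" and lt: "norm (z powi prod_a a * inverse t) < 1" by auto
  define y where "y = z powi (- prod_a a) * t"
  have iy: "inverse y = z powi prod_a a * inverse t" using tz by (simp add: y_def power_int_minus)
  have y0: "y \<noteq> 0" using tz by (simp add: y_def)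
  have "norm (inverse y) < 1" using lt iy by simp
  then have "norm y > 1" using y0 by (simp add: norm_inverse inverse_less_1_iff)
  from has_sum_collected[OF tz has_sum_odd_geometric_neg[OF this, unfolded y_def], of 1]
  show "((\<lambda>(n, r). complex_of_real (collected a {n. odd n \<and> n < 0} (\<lambda>n e. 1 * of_int (sign_prod e)) (n, r)) *
      z powi n * t powi r) has_sum f0 a t z) UNIV"
    unfolding f0_legs y_def[symmetric] iy[symmetric]
    by (simp add: minus_divide_right)
qed (auto simp: norm_mult norm_power_int norm_inverse)

lemma laurent_expansion_infinity:
  "laurent_expansion {(t, z). t \<noteq> 0 \<and> z \<noteq> 0 \<and> norm (z powi prod_a a * inverse t) > 1} (f0 a) =
   collected a {n. odd n \<and> n > 0} (\<lambda>n e. (- 1) * of_int (sign_prod e))"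
proof (rule laurent_expansion_eqI[where ?t0.0 = "1 / 2" and ?z0.0 = 1])
  fix t z :: complex
  assume "(t, z) \<in> {(t, z). t \<noteq> 0 \<and> z \<noteq> 0 \<and> norm (z powi prod_a a * inverse t) > 1}"
  then have tz: "t \<noteq> 0" "z \<noteq> 0" and gt: "norm (z powi prod_a a * inverse t) > 1" by auto
  define y where "y = z powi (- prod_a a) * t"
  have iy: "inverse y = z powi prod_a a * inverse t" using tz by (simp add: y_def power_int_minus)
  have y0: "y \<noteq> 0" using tz by (simp add: y_def)
  have "norm (inverse y) > 1" using gt iy by simp
  then have "norm y < 1" using y0 by (simp add: norm_inverse one_less_inverse_iff)
  from has_sum_collected[OF tz has_sum_odd_geometric[OF y0 this, unfolded y_def], of "- 1"]
  show "((\<lambda>(n, r). complex_of_real (collected a {n. odd n \<and> n > 0} (\<lambda>n e. (- 1) * of_int (sign_prod e)) (n, r)) *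
      z powi n * t powi r) has_sum f0 a t z) UNIV"
    unfolding f0_legs y_def[symmetric] iy[symmetric] by simp
qed (auto simp: norm_mult norm_power_int norm_inverse norm_divide)

text \<open>The weights \<open>1 - w\<close> and \<open>w\<close> of the two expansions become the factors \<open>w - 1\<close> on negative and \<open>w\<close> on
  positive \<open>n\<close>, the shape of \<open>W\<^sub>3\<close> on the odd integers.\<close>

lemma asym_expansion_f0:
  "asym_expansion (prod_a a) w (f0 a) =
   collected a {n. odd n} (\<lambda>n e. (if n > 0 then w else w - 1) * - of_int (sign_prod e))"
proof
  fix p
  let ?F = "\<lambda>N. {x \<in> N \<times> signs. (z_exp a (fst x) (snd x), t_exp (fst x) (snd x)) = p}"
  let ?w = "\<lambda>x. (if fst x > 0 then w else w - 1) * - real_of_int (sign_prod (snd x))"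
  have split: "?F {n. odd n} = ?F {n. odd n \<and> n < 0} \<union> ?F {n. odd n \<and> n > 0}"
  proof -
    have "n < 0 \<or> n > 0" if "odd n" for n :: int using that by (cases n "0 :: int" rule: linorder_cases) auto
    then show ?thesis by auto
  qed
  have "(\<Sum>x\<in>?F {n. odd n}. ?w x) = (\<Sum>x\<in>?F {n. odd n \<and> n < 0}. ?w x) + (\<Sum>x\<in>?F {n. odd n \<and> n > 0}. ?w x)"
    unfolding split by (rule sum.union_disjoint[OF finite_exp_fibre finite_exp_fibre]) auto
  also have "(\<Sum>x\<in>?F {n. odd n \<and> n < 0}. ?w x) =
      (1 - w) * (\<Sum>x\<in>?F {n. odd n \<and> n < 0}. real_of_int (sign_prod (snd x)))"
    unfolding sum_distrib_left by (rule sum.cong) (auto simp: algebra_simps)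
  also have "(\<Sum>x\<in>?F {n. odd n \<and> n > 0}. ?w x) =
      w * (\<Sum>x\<in>?F {n. odd n \<and> n > 0}. - real_of_int (sign_prod (snd x)))"
    unfolding sum_distrib_left by (rule sum.cong) auto
  finally show "asym_expansion (prod_a a) w (f0 a) p =
     collected a {n. odd n} (\<lambda>n e. (if n > 0 then w else w - 1) * - of_int (sign_prod e)) p"
    unfolding asym_expansion_def laurent_expansion_zero laurent_expansion_infinity collected_def
    by (simp add: case_prod_unfold)
qed

text \<open>Only the exponents \<open>n\<close> and \<open>-n\<close> of \<open>z\<close> are sent to the same power of \<open>q\<close>, so the coefficients on the left are
  finite sums that can be regrouped.\<close>

lemma laplace_collected:
  assumes A: "prod_a a \<noteq> 0"
  shows "laplace (prod_a a) (collected a N w) (\<alpha>, \<beta>) =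
    (\<Sum>(n, e)\<in>{(n, e). n \<in> N \<and> e \<in> signs \<and>
        rat_of_int ((z_exp a n e)\<^sup>2) / (4 * rat_of_int (prod_a a)) = \<alpha> \<and> rat_of_int (t_exp n e) = \<beta>}. w n e)"
proof -
  define P where "P = {(n, r). rat_of_int (n\<^sup>2) / (4 * rat_of_int (prod_a a)) = \<alpha> \<and> rat_of_int r = \<beta>}"
  define \<phi> where "\<phi> x = (z_exp a (fst x) (snd x), t_exp (fst x) (snd x))" for x
  define X where "X = {x \<in> N \<times> signs. \<phi> x \<in> P}"
  have finP: "finite P"
  proof (cases "P = {}")
    case False
    then obtain n0 r0 where p0: "(n0, r0) \<in> P" by auto
    have "P \<subseteq> {n0, - n0} \<times> {r0}"
    proof (clarify)
      fix n r assume "(n, r) \<in> P"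
      then have "rat_of_int (n\<^sup>2) / (4 * rat_of_int (prod_a a)) = rat_of_int (n0\<^sup>2) / (4 * rat_of_int (prod_a a))"
        "rat_of_int r = rat_of_int r0"
        using p0 by (simp_all add: P_def)
      then have "n\<^sup>2 = n0\<^sup>2" "r = r0" using A by (simp_all add: divide_cancel_right del: of_int_power)
      then show "n \<in> {n0, - n0} \<and> r \<in> {r0}" by (auto simp: power2_eq_iff)
    qed
    then show ?thesis by (rule finite_subset) simp
  qed simp
  have "X \<subseteq> (\<Union>p\<in>P. {x \<in> N \<times> signs. \<phi> x = p})" by (auto simp: X_def)
  then have finX: "finite X"
    by (rule finite_subset) (use finP finite_exp_fibre in \<open>auto simp: \<phi>_def\<close>)
  have "laplace (prod_a a) (collected a N w) (\<alpha>, \<beta>) =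
     (\<Sum>p\<in>{p \<in> P. collected a N w p \<noteq> 0}. collected a N w p)"
    unfolding laplace_def monomial_sum_def P_def by (auto intro!: sum.cong)
  also have "\<dots> = (\<Sum>p\<in>P. collected a N w p)"
    using finP by (intro sum.mono_neutral_left) auto
  also have "\<dots> = (\<Sum>p\<in>P. \<Sum>x\<in>{x \<in> X. \<phi> x = p}. w (fst x) (snd x))"
    unfolding collected_def by (intro sum.cong) (auto simp: X_def \<phi>_def case_prod_unfold)
  also have "\<dots> = (\<Sum>x\<in>X. w (fst x) (snd x))"
    by (rule sum.group[OF finX finP]) (auto simp: X_def)
  also have "\<dots> = (\<Sum>(n, e)\<in>{(n, e). n \<in> N \<and> e \<in> signs \<and>
        rat_of_int ((z_exp a n e)\<^sup>2) / (4 * rat_of_int (prod_a a)) = \<alpha> \<and> rat_of_int (t_exp n e) = \<beta>}. w n e)"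
    by (intro sum.cong) (auto simp: X_def \<phi>_def P_def)
  finally show ?thesis .
qed

section \<open>Values of an admissible family\<close>

lemma admissible_W2:
  assumes "admissible_family W"
  shows "W 2 r = (if r = 0 then 1 else 0)"
  using assms by (simp add: admissible_family_def)

lemma admissible_step:
  assumes "admissible_family W"
  shows "W (Suc n) (r + 1) = W (Suc n) (r - 1) + W n r"
proof -
  have "W (Suc n) (r + 1) - W (Suc n) (r - 1) = W (Suc n - 1) r"
    using assms unfolding admissible_family_def by (metis le_add1 plus_1_eq_Suc)
  then show ?thesis by simp
qed

lemma admissible_W1:
  assumes "admissible_family W"
  shows "W 1 r = (if r = - 1 then 1 else if r = 1 then - 1 else 0)"
  using admissible_step[OF assms, of 1 r] admissible_W2[OF assms] by (auto simp: numeral_2_eq_2)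

text \<open>\<open>W\<^sub>3\<close> jumps by \<open>W\<^sub>2(r)\<close> between \<open>r - 1\<close> and \<open>r + 1\<close>, that is, only between \<open>-1\<close> and \<open>1\<close>.\<close>

lemma admissible_W3:
  assumes W: "admissible_family W" and "odd n"
  shows "W 3 n = (if n > 0 then W 3 1 else W 3 1 - 1)"
proof -
  have step: "W 3 (r + 1) = W 3 (r - 1) + (if r = 0 then 1 else 0)" for r
    using admissible_step[OF W, of 2 r] admissible_W2[OF W, of r] by (simp add: numeral_3_eq_3)
  have pos: "W 3 (2 * int k + 1) = W 3 1" for k
  proof (induction k)
    case (Suc k)
    then show ?case using step[of "2 * int k + 2"] by (simp add: algebra_simps)
  qed simp
  have neg: "W 3 (- 1 - 2 * int k) = W 3 1 - 1" for k
  proof (induction k)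
    case 0
    then show ?case using step[of 0] by simp
  next
    case (Suc k)
    then show ?case using step[of "- 2 - 2 * int k"] by (simp add: algebra_simps)
  qed
  obtain m where m: "n = 2 * m + 1" using \<open>odd n\<close> by (elim oddE)
  show ?thesis
  proof (cases "m \<ge> 0")
    case True
    then show ?thesis using pos[of "nat m"] m by simp
  next
    case False
    then have "n = - 1 - 2 * int (nat (- m - 1))" using m by simp
    then show ?thesis using neg[of "nat (- m - 1)"] False m by (simp add: add.commute)
  qed
qed

section \<open>The invariant as a sum over node and leaf values\<close>

context star_plumbing begin

text \<open>The vector whose entries are the arguments of the functions \<open>W\<close> in the weight of \<open>x\<close>.\<close>

definition shifted :: "int vec \<Rightarrow> int vec \<Rightarrow> int vec" where
  "shifted k x = 2 \<cdot>\<^sub>v (M *\<^sub>v x) + k - M *\<^sub>v ones \<Gamma>"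

lemma ones_eq: "ones \<Gamma> = vec s (\<lambda>_. 1)" by (simp add: ones_def)

lemma ones_carrier [simp]: "ones \<Gamma> \<in> carrier_vec s" by (simp add: ones_def)

lemma M_mult_carrier [simp]: "x \<in> carrier_vec s \<Longrightarrow> M *\<^sub>v x \<in> carrier_vec s"
  by (rule mult_mat_vec_carrier[OF M_carrier])

lemma M'_mult_carrier [simp]: "x \<in> carrier_vec s \<Longrightarrow> M' *\<^sub>v x \<in> carrier_vec s"
  by (rule mult_mat_vec_carrier[OF M'_carrier])

lemma shifted_carrier [simp]:
  "k \<in> carrier_vec s \<Longrightarrow> x \<in> carrier_vec s \<Longrightarrow> shifted k x \<in> carrier_vec s"
  by (simp add: shifted_def)

lemma mult_mat_smult_vec:
  fixes B :: "int mat"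
  assumes "B \<in> carrier_mat s s" "x \<in> carrier_vec s"
  shows "B *\<^sub>v (k \<cdot>\<^sub>v x) = k \<cdot>\<^sub>v (B *\<^sub>v x)"
  using assms by (intro eq_vecI) (auto simp: scalar_prod_smult_distrib[where n = s])

lemma M_ones_node: "(M *\<^sub>v ones \<Gamma>) $ 0 = - b + 3"
  using s_pos M_mult_node[of "\<lambda>_. 1"] by (simp add: ones_eq card_legs)

lemma M_ones_leg:
  assumes "i \<in> legs" "p < length (c i)"
  shows "(M *\<^sub>v ones \<Gamma>) $ pos i p = - (c i ! p) + (if Suc p < length (c i) then 2 else 1)"
  using M_mult_leg[OF assms, of "\<lambda>_. 1"] pos_range(2)[OF assms] by (auto simp: ones_eq)

lemma char_vectors_carrier: "k \<in> char_vectors \<Gamma> \<Longrightarrow> k \<in> carrier_vec s"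
  by (simp add: char_vectors_def)

text \<open>Since \<open>Mu = m + \<delta>\<close>, being characteristic means for \<open>shifted k x\<close> to have the parity of the vertex
  degrees.\<close>

lemma char_vectors_iff_shifted:
  assumes k: "k \<in> carrier_vec s" and x: "x \<in> carrier_vec s"
  shows "k \<in> char_vectors \<Gamma> \<longleftrightarrow> odd (shifted k x $ 0) \<and>
    (\<forall>i\<in>legs. \<forall>p<length (c i). even (shifted k x $ pos i p) \<longleftrightarrow> Suc p < length (c i))"
proof -
  have sh: "shifted k x $ v = 2 * (M *\<^sub>v x) $ v + k $ v - (M *\<^sub>v ones \<Gamma>) $ v" if "v < s" for v
    using that k x M_mult_carrier[OF x] M_mult_carrier[OF ones_carrier]
    by (simp add: shifted_def del: M_mult_carrier)
  have node: "odd (shifted k x $ 0) \<longleftrightarrow> even (k $ 0 - weight \<Gamma> 0)"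
    using s_pos by (simp add: sh M_ones_node weight_node)
  have leg: "(even (shifted k x $ pos i p) \<longleftrightarrow> Suc p < length (c i)) \<longleftrightarrow>
      even (k $ pos i p - weight \<Gamma> (pos i p))" if "i \<in> legs" "p < length (c i)" for i p
    using pos_range[OF that] by (auto simp: sh M_ones_leg[OF that] weight_pos[OF that])
  have "k \<in> char_vectors \<Gamma> \<longleftrightarrow> (\<forall>v<s. even (k $ v - weight \<Gamma> v))"
    using k by (simp add: char_vectors_def)
  also have "\<dots> \<longleftrightarrow> even (k $ 0 - weight \<Gamma> 0) \<and>
      (\<forall>i\<in>legs. \<forall>p<length (c i). even (k $ pos i p - weight \<Gamma> (pos i p)))"
    using all_vertices[of "\<lambda>v. even (k $ v - weight \<Gamma> v)"] s_pos pos_range(2) by blast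
  also have "\<dots> \<longleftrightarrow> odd (shifted k x $ 0) \<and>
    (\<forall>i\<in>legs. \<forall>p<length (c i). even (shifted k x $ pos i p) \<longleftrightarrow> Suc p < length (c i))"
    using node leg by blast
  finally show ?thesis .
qed

lemma W_graph_eq:
  "W_graph W \<Gamma> k x = W 3 (shifted k x $ 0) *
     (\<Prod>i\<in>legs. \<Prod>p<length (c i). W (if Suc p < length (c i) then 2 else 1) (shifted k x $ pos i p))"
  unfolding W_graph_def shifted_def[symmetric] prod_vertices
  by (simp add: vertex_degree_node vertex_degree_leg)

lemma leaf_vec_leg:
  assumes "i \<in> legs" "p < length (c i)"
  shows "leaf_vec n e $ pos i p = (if Suc p < length (c i) then 0 else e i)"
proof (cases "Suc p < length (c i)")
  case True
  then show ?thesis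
    using pos_range[OF assms] leg_pos_leaf_iff[OF assms] by (simp add: leaf_vec_def)
next
  case False
  then have "p = length (c i) - 1" using assms(2) by simp
  then show ?thesis using leaf_pos(3)[OF assms(1)] assms False by simp
qed

lemma W_graph_leaf_vec:
  assumes W: "admissible_family W" and e: "e \<in> signs" and n: "odd n"
    and sh: "shifted k x = leaf_vec n e"
  shows "W_graph W \<Gamma> k x = (if n > 0 then W 3 1 else W 3 1 - 1) * - of_int (sign_prod e)"
proof -
  have "(\<Prod>p<length (c i). W (if Suc p < length (c i) then 2 else 1) (leaf_vec n e $ pos i p)) =
      - of_int (e i)" if i: "i \<in> legs" for i
  proof -
    have "(\<Prod>p<length (c i). W (if Suc p < length (c i) then 2 else 1) (leaf_vec n e $ pos i p)) =
        (\<Prod>p<length (c i). if p = length (c i) - 1 then W 1 (e i) else 1)"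
      by (intro prod.cong refl) (use leaf_vec_leg[OF i] admissible_W2[OF W] in auto)
    also have "\<dots> = W 1 (e i)" using leaf_pos(4)[OF i] by (subst prod.delta) auto
    finally show ?thesis using e i admissible_W1[OF W, of "e i"] by (auto simp: signs_def PiE_iff)
  qed
  then have "W_graph W \<Gamma> k x = W 3 n * (\<Prod>i\<in>legs. - of_int (e i))"
    unfolding W_graph_eq sh by simp
  also have "(\<Prod>i\<in>legs. - real_of_int (e i)) = - of_int (sign_prod e)"
    unfolding prod_uminus card_legs sign_prod_def by simp
  finally show ?thesis by (simp only: admissible_W3[OF W n])
qed

text \<open>\<open>W\<^sub>2\<close> forces zeros at the inner vertices of the legs, \<open>W\<^sub>1\<close> forces signs at the leaves, and the parity
  of characteristic vectors makes the entry at the node odd.\<close>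

lemma W_graph_nonzero:
  assumes W: "admissible_family W" and k: "k \<in> char_vectors \<Gamma>" and x: "x \<in> carrier_vec s"
    and nz: "W_graph W \<Gamma> k x \<noteq> 0"
  shows "odd (shifted k x $ 0)" "restrict (\<lambda>i. shifted k x $ i) legs \<in> signs"
    and "shifted k x = leaf_vec (shifted k x $ 0) (restrict (\<lambda>i. shifted k x $ i) legs)"
proof -
  show odd: "odd (shifted k x $ 0)"
    using char_vectors_iff_shifted[OF char_vectors_carrier[OF k] x] k by blast
  have factor: "W (if Suc p < length (c i) then 2 else 1) (shifted k x $ pos i p) \<noteq> 0"
    if "i \<in> legs" "p < length (c i)" for i p
    using nz that unfolding W_graph_eq by auto
  have inner: "shifted k x $ pos i p = 0" if "i \<in> legs" "Suc p < length (c i)" for i p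
    using factor[OF that(1), of p] that(2) admissible_W2[OF W] by (auto split: if_splits)
  have leaf: "shifted k x $ i \<in> {- 1, 1}" if "i \<in> legs" for i
    using factor[OF that leaf_pos(4)[OF that]] leaf_pos(3)[OF that] len_pos[OF that] admissible_W1[OF W]
    by (auto split: if_splits)
  show "restrict (\<lambda>i. shifted k x $ i) legs \<in> signs"
    using leaf by (auto simp: signs_def)
  show "shifted k x = leaf_vec (shifted k x $ 0) (restrict (\<lambda>i. shifted k x $ i) legs)"
  proof (rule eq_vecI)
    fix v assume "v < dim_vec (leaf_vec (shifted k x $ 0) (restrict (\<lambda>i. shifted k x $ i) legs))"
    then have "v < s" by (simp add: leaf_vec_def)
    then show "shifted k x $ v = leaf_vec (shifted k x $ 0) (restrict (\<lambda>i. shifted k x $ i) legs) $ v"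
    proof (cases rule: vertex_cases)
      case (leg i p)
      show ?thesis
      proof (cases "Suc p < length (c i)")
        case True
        then show ?thesis using leg inner by (simp add: leaf_vec_leg)
      next
        case False
        then have "p = length (c i) - 1" using leg(2) by simp
        then show ?thesis using leaf_pos(3)[OF leg(1)] leg False by simp
      qed
    qed simp
  qed (use shifted_carrier[OF char_vectors_carrier[OF k] x] in \<open>simp add: leaf_vec_def\<close>)
qed

lemma Theta_shifted:
  assumes k: "k \<in> carrier_vec s" and x: "x \<in> carrier_vec s"
  shows "Theta \<Gamma> k + rat_of_int (lat_form \<Gamma> x (ones \<Gamma>)) = rat_of_int (shifted k x \<bullet> ones \<Gamma>) / 2"
proof -
  have "shifted k x \<bullet> ones \<Gamma> = 2 * ((M *\<^sub>v x) \<bullet> ones \<Gamma>) + k \<bullet> ones \<Gamma> - (M *\<^sub>v ones \<Gamma>) \<bullet> ones \<Gamma>"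
    using k x unfolding shifted_def
    by (subst minus_scalar_prod_distrib[where n = s], auto)
      (subst add_scalar_prod_distrib[where n = s],
        auto simp: smult_scalar_prod_distrib[OF M_mult_carrier[OF x] ones_carrier])
  also have "(M *\<^sub>v x) \<bullet> ones \<Gamma> = lat_form \<Gamma> x (ones \<Gamma>)"
    using M_self_adjoint[OF x ones_carrier] by (simp add: lat_form_def)
  also have "(M *\<^sub>v ones \<Gamma>) \<bullet> ones \<Gamma> = lat_form \<Gamma> (ones \<Gamma>) (ones \<Gamma>)"
    using M_self_adjoint[OF ones_carrier ones_carrier] by (simp add: lat_form_def)
  finally show ?thesis by (simp add: Theta_def field_simps)
qed

lemma leaf_vec_ones: "leaf_vec n e \<bullet> ones \<Gamma> = t_exp n e"
proof -
  have "leaf_vec n e \<bullet> ones \<Gamma> = (\<Sum>v<s. leaf_vec n e $ v)"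
    by (simp add: scalar_prod_def ones_def atLeast0LessThan)
  then show ?thesis using sum_leaf_vec[of "\<lambda>_ x. x" n e] by (simp add: t_exp_def)
qed

text \<open>Completing the square: with \<open>v = k - Mu\<close>, the form of \<open>M'\<close> at \<open>2Mx + v\<close> is
  \<open>h(4\<langle>x,x\<rangle> + 4x \<cdot> v) + v\<^sup>tM'v\<close>, which collects all terms of the exponent that depend on \<open>x\<close>.\<close>

lemma eps_shifted:
  assumes k: "k \<in> carrier_vec s" and x: "x \<in> carrier_vec s"
  shows "rat_of_int h * eps \<Gamma> k x = - (rat_of_int (shifted k x \<bullet> (M' *\<^sub>v shifted k x)) +
     rat_of_int h * (3 * of_nat s + rat_of_int (\<Sum>i<s. weight \<Gamma> i))) / 4"
proof -
  define v where "v = k - M *\<^sub>v ones \<Gamma>"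
  have v: "v \<in> carrier_vec s" using k by (simp add: v_def)
  have M'v: "M' *\<^sub>v v \<in> carrier_vec s" using v by simp
  let ?y = "2 \<cdot>\<^sub>v (M *\<^sub>v x)"
  have y: "?y \<in> carrier_vec s" using x by simp
  have sh: "shifted k x = ?y + v"
    using k x M_mult_carrier[OF x] M_mult_carrier[OF ones_carrier]
    unfolding shifted_def v_def by (intro eq_vecI) (auto simp del: M_mult_carrier)
  have inv: "rat_of_int h * (map_vec rat_of_int v \<bullet> (plumbing_inv \<Gamma> *\<^sub>v map_vec rat_of_int v)) =
      rat_of_int (v \<bullet> (M' *\<^sub>v v))"
  proof -
    have "plumbing_inv \<Gamma> *\<^sub>v map_vec rat_of_int v =
        (1 / rat_of_int h) \<cdot>\<^sub>v map_vec rat_of_int (M' *\<^sub>v v)"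
      unfolding plumbing_inv_eq of_int_hom.mult_mat_vec_hom[OF M'_carrier v]
      using v by (intro eq_vecI) auto
    then have "map_vec rat_of_int v \<bullet> (plumbing_inv \<Gamma> *\<^sub>v map_vec rat_of_int v) =
       (1 / rat_of_int h) * (map_vec rat_of_int v \<bullet> map_vec rat_of_int (M' *\<^sub>v v))"
      using v M'v by (simp add: scalar_prod_smult_distrib[where n = s])
    moreover have "map_vec rat_of_int v \<bullet> map_vec rat_of_int (M' *\<^sub>v v) = rat_of_int (v \<bullet> (M' *\<^sub>v v))"
      using v M'v by (simp add: scalar_prod_def del: M'_mult_carrier)
    ultimately show ?thesis using h_pos by simp
  qed
  have M'y: "M' *\<^sub>v ?y = (2 * h) \<cdot>\<^sub>v x"
  proof -
    have "M' *\<^sub>v ?y = 2 \<cdot>\<^sub>v (M' *\<^sub>v (M *\<^sub>v x))"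
      using x by (intro mult_mat_smult_vec) simp_all
    then show ?thesis using M'_M_vec[OF x] by (simp add: smult_smult_assoc)
  qed
  have My: "M *\<^sub>v ((2 * h) \<cdot>\<^sub>v x) = (2 * h) \<cdot>\<^sub>v (M *\<^sub>v x)"
    by (rule mult_mat_smult_vec[OF M_carrier x])
  have yM'v: "?y \<bullet> (M' *\<^sub>v v) = 2 * h * (x \<bullet> v)"
  proof -
    have "?y \<bullet> (M' *\<^sub>v v) = 2 * ((M *\<^sub>v x) \<bullet> (M' *\<^sub>v v))"
      using x M'v by (intro smult_scalar_prod_distrib[where n = s]) auto
    also have "(M *\<^sub>v x) \<bullet> (M' *\<^sub>v v) = x \<bullet> (M *\<^sub>v (M' *\<^sub>v v))"
      by (rule M_self_adjoint[OF x M'v])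
    also have "\<dots> = h * (x \<bullet> v)"
      using M_M'_vec[OF v] x v by (simp add: scalar_prod_smult_distrib[where n = s])
    finally show ?thesis by simp
  qed
  have yx: "?y \<bullet> ((2 * h) \<cdot>\<^sub>v x) = 4 * h * lat_form \<Gamma> x x"
  proof -
    have "?y \<bullet> ((2 * h) \<cdot>\<^sub>v x) = 2 * ((M *\<^sub>v x) \<bullet> ((2 * h) \<cdot>\<^sub>v x))"
      using x by (intro smult_scalar_prod_distrib[where n = s]) auto
    also have "(M *\<^sub>v x) \<bullet> ((2 * h) \<cdot>\<^sub>v x) = 2 * h * ((M *\<^sub>v x) \<bullet> x)"
      using x by (intro scalar_prod_smult_distrib[where n = s]) auto
    also have "(M *\<^sub>v x) \<bullet> x = lat_form \<Gamma> x x" using M_self_adjoint[OF x x] by (simp add: lat_form_def)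
    finally show ?thesis by simp
  qed
  have vx: "v \<bullet> ((2 * h) \<cdot>\<^sub>v x) = 2 * h * (v \<bullet> x)"
    using v x by (intro scalar_prod_smult_distrib[where n = s]) auto
  have comm: "x \<bullet> v = v \<bullet> x" by (rule comm_scalar_prod[OF x v])
  have vxk: "v \<bullet> x = k \<bullet> x - lat_form \<Gamma> x (ones \<Gamma>)"
  proof -
    have "v \<bullet> x = k \<bullet> x - (M *\<^sub>v ones \<Gamma>) \<bullet> x"
      unfolding v_def using k x by (intro minus_scalar_prod_distrib[where n = s]) auto
    also have "(M *\<^sub>v ones \<Gamma>) \<bullet> x = x \<bullet> (M *\<^sub>v ones \<Gamma>)"
      by (rule comm_scalar_prod[where n = s]) (use x in auto)
    finally show ?thesis by (simp add: lat_form_def)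
  qed
  have "shifted k x \<bullet> (M' *\<^sub>v shifted k x) = (?y + v) \<bullet> ((2 * h) \<cdot>\<^sub>v x + M' *\<^sub>v v)"
    unfolding sh mult_add_distrib_mat_vec[OF M'_carrier y v] M'y ..
  also have "\<dots> = (?y + v) \<bullet> ((2 * h) \<cdot>\<^sub>v x) + (?y + v) \<bullet> (M' *\<^sub>v v)"
    using y v x M'v by (intro scalar_prod_add_distrib[where n = s]) auto
  also have "(?y + v) \<bullet> ((2 * h) \<cdot>\<^sub>v x) = ?y \<bullet> ((2 * h) \<cdot>\<^sub>v x) + v \<bullet> ((2 * h) \<cdot>\<^sub>v x)"
    using y v x by (intro add_scalar_prod_distrib[where n = s]) auto
  also have "(?y + v) \<bullet> (M' *\<^sub>v v) = ?y \<bullet> (M' *\<^sub>v v) + v \<bullet> (M' *\<^sub>v v)"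
    using y v M'v by (intro add_scalar_prod_distrib[where n = s]) auto
  finally have form: "shifted k x \<bullet> (M' *\<^sub>v shifted k x) =
     4 * h * lat_form \<Gamma> x x + 4 * h * (k \<bullet> x - lat_form \<Gamma> x (ones \<Gamma>)) + v \<bullet> (M' *\<^sub>v v)"
    unfolding yM'v yx vx comm vxk by (simp add: algebra_simps)
  have "rat_of_int h * eps \<Gamma> k x =
     - (rat_of_int h * (map_vec rat_of_int v \<bullet> (plumbing_inv \<Gamma> *\<^sub>v map_vec rat_of_int v)) +
        rat_of_int h * (3 * of_nat s + rat_of_int (\<Sum>i<s. weight \<Gamma> i))) / 4 +
     rat_of_int h * (2 * chi \<Gamma> k x + rat_of_int (lat_form \<Gamma> x (ones \<Gamma>)))"
    unfolding eps_def Let_def v_def[symmetric] by (simp add: algebra_simps add_divide_distrib diff_divide_distrib)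
  then show ?thesis
    unfolding inv form chi_def by (simp add: field_simps)
qed

lemma eps_leaf_vec:
  assumes k: "k \<in> carrier_vec s" and x: "x \<in> carrier_vec s"
    and e: "e \<in> signs" and sh: "shifted k x = leaf_vec n e"
  shows "rat_of_int h * eps \<Gamma> k x =
     rat_of_int ((z_exp a n e)\<^sup>2) / (4 * rat_of_int A) + Delta a \<Gamma>"
proof -
  have trace: "(\<Sum>i<s. M $$ (i, i)) = (\<Sum>i<s. weight \<Gamma> i)"
    by (rule sum.cong) (auto simp: plumbing_mat_def)
  have Delta: "Delta a \<Gamma> = - (rat_of_int h * (3 * of_nat s + rat_of_int (\<Sum>i<s. weight \<Gamma> i))) / 4
      - (\<Sum>i\<in>legs. rat_of_int (M' $$ (i, i)) + rat_of_int A / (rat_of_int (a i))\<^sup>2) / 4"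
    unfolding Delta_def Let_def M'_def[symmetric] H1_order_eq trace legs_def[symmetric] by simp
  have squares: "(rat_of_int (e i))\<^sup>2 = 1" if "i \<in> legs" for i
    using e that by (auto simp: signs_def PiE_iff)
  have "rat_of_int (z_exp a n e) = - rat_of_int A * (rat_of_int n + (\<Sum>i\<in>legs. rat_of_int (e i) / rat_of_int (a i)))"
  proof -
    have "rat_of_int (abar i) = rat_of_int A / rat_of_int (a i)" if "i \<in> legs" for i
      using a_abar[OF that] a_pos[OF that] by (simp add: field_simps flip: of_int_mult)
    then show ?thesis by (simp add: z_exp_def sum_distrib_left sum_negf algebra_simps)
  qed
  then have z: "rat_of_int ((z_exp a n e)\<^sup>2) / (4 * rat_of_int A) =
      rat_of_int A * (rat_of_int n + (\<Sum>i\<in>legs. rat_of_int (e i) / rat_of_int (a i)))\<^sup>2 / 4"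
    using A_pos by (simp add: power_mult_distrib power2_eq_square)
  have "rat_of_int (leaf_vec n e \<bullet> (M' *\<^sub>v leaf_vec n e)) =
     - rat_of_int A * (rat_of_int n + (\<Sum>i\<in>legs. rat_of_int (e i) / rat_of_int (a i)))\<^sup>2 +
     (\<Sum>i\<in>legs. rat_of_int (M' $$ (i, i)) + rat_of_int A / (rat_of_int (a i))\<^sup>2)"
    unfolding quadratic_form_leaf_vec by (simp add: squares)
  then show ?thesis
    unfolding eps_shifted[OF k x] sh z Delta by (simp add: field_simps)
qed

section \<open>Summation over all spin-c structures\<close>

definition spinc_rel :: "(int vec \<times> int vec) set" where
  "spinc_rel = {(k, k'). k \<in> char_vectors \<Gamma> \<and> k' \<in> char_vectors \<Gamma> \<and>
        (\<exists>x \<in> carrier_vec s. k' = k + 2 \<cdot>\<^sub>v (M *\<^sub>v x))}"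

lemma spinc_eq: "spinc \<Gamma> = char_vectors \<Gamma> // spinc_rel"
  by (simp add: spinc_def spinc_rel_def)

lemma M_mult_add:
  assumes "x \<in> carrier_vec s" "y \<in> carrier_vec s"
  shows "M *\<^sub>v (x + y) = M *\<^sub>v x + M *\<^sub>v y"
  by (rule mult_add_distrib_mat_vec[OF M_carrier assms])

lemma M_mult_minus:
  assumes "x \<in> carrier_vec s" "y \<in> carrier_vec s"
  shows "M *\<^sub>v (x - y) = M *\<^sub>v x - M *\<^sub>v y"
  by (rule mult_minus_distrib_mat_vec[OF M_carrier assms])

lemma M_mult_inj:
  assumes "x \<in> carrier_vec s" "y \<in> carrier_vec s" "M *\<^sub>v x = M *\<^sub>v y"
  shows "x = y"
proof (rule eq_vecI)
  fix i assume i: "i < dim_vec y"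
  have "h \<cdot>\<^sub>v x = h \<cdot>\<^sub>v y" using M'_M_vec[OF assms(1)] M'_M_vec[OF assms(2)] assms(3) by simp
  from arg_cong[OF this, of "\<lambda>v. v $ i"] show "x $ i = y $ i"
    using h_pos assms(1,2) i by simp
qed (use assms in simp)

lemma index_M_mult_add:
  assumes "x \<in> carrier_vec s" "y \<in> carrier_vec s" "i < s"
  shows "(M *\<^sub>v (x + y)) $ i = (M *\<^sub>v x) $ i + (M *\<^sub>v y) $ i"
    and "(M *\<^sub>v (x - y)) $ i = (M *\<^sub>v x) $ i - (M *\<^sub>v y) $ i"
  using M_mult_add[OF assms(1,2)] M_mult_minus[OF assms(1,2)] M_mult_carrier[OF assms(1)]
    M_mult_carrier[OF assms(2)] assms(3) by (simp_all del: M_mult_carrier index_mult_mat_vec)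

lemma spinc_relI:
  assumes "k \<in> char_vectors \<Gamma>" "k' \<in> char_vectors \<Gamma>" "x \<in> carrier_vec s"
    and "\<And>i. i < s \<Longrightarrow> k' $ i = k $ i + 2 * (M *\<^sub>v x) $ i"
  shows "(k, k') \<in> spinc_rel"
proof -
  have "k' = k + 2 \<cdot>\<^sub>v (M *\<^sub>v x)"
    using assms(4) char_vectors_carrier[OF assms(1)] char_vectors_carrier[OF assms(2)]
      M_mult_carrier[OF assms(3)]
    by (intro eq_vecI) (auto simp del: M_mult_carrier index_mult_mat_vec)
  then show ?thesis using assms(1-3) by (auto simp: spinc_rel_def)
qed

lemma spinc_relE:
  assumes "(k, k') \<in> spinc_rel"
  obtains x where "k \<in> char_vectors \<Gamma>" "k' \<in> char_vectors \<Gamma>" "x \<in> carrier_vec s"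
    and "\<And>i. i < s \<Longrightarrow> k' $ i = k $ i + 2 * (M *\<^sub>v x) $ i"
proof -
  obtain x where x: "k \<in> char_vectors \<Gamma>" "k' \<in> char_vectors \<Gamma>" "x \<in> carrier_vec s"
    "k' = k + 2 \<cdot>\<^sub>v (M *\<^sub>v x)" using assms by (auto simp: spinc_rel_def)
  have "k' $ i = k $ i + 2 * (M *\<^sub>v x) $ i" if "i < s" for i
    using that x(4) char_vectors_carrier[OF x(1)] M_mult_carrier[OF x(3)]
    by (simp del: M_mult_carrier index_mult_mat_vec)
  then show ?thesis using that x by blast
qed

lemma equiv_spinc_rel: "equiv (char_vectors \<Gamma>) spinc_rel"
proof (rule equivI)
  show "spinc_rel \<subseteq> char_vectors \<Gamma> \<times> char_vectors \<Gamma>" by (auto simp: spinc_rel_def)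
  show "refl_on (char_vectors \<Gamma>) spinc_rel"
  proof (rule refl_onI)
    fix k assume "k \<in> char_vectors \<Gamma>"
    then show "(k, k) \<in> spinc_rel"
      by (intro spinc_relI[where x = "0\<^sub>v s"]) (auto simp: scalar_prod_def)
  qed
  show "sym spinc_rel"
  proof (rule symI)
    fix k k' assume "(k, k') \<in> spinc_rel"
    then obtain x where x: "k \<in> char_vectors \<Gamma>" "k' \<in> char_vectors \<Gamma>" "x \<in> carrier_vec s"
      "\<And>i. i < s \<Longrightarrow> k' $ i = k $ i + 2 * (M *\<^sub>v x) $ i" by (rule spinc_relE) blast
    have "(M *\<^sub>v (0\<^sub>v s - x)) $ i = - (M *\<^sub>v x) $ i" if "i < s" for i
      using that x(3) index_M_mult_add(2)[OF zero_carrier_vec x(3) that]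
      by (simp add: scalar_prod_def)
    then show "(k', k) \<in> spinc_rel"
      using x by (intro spinc_relI[where x = "0\<^sub>v s - x"]) (auto simp del: index_mult_mat_vec)
  qed
  show "trans spinc_rel"
  proof (rule transI)
    fix k k' k'' assume kk: "(k, k') \<in> spinc_rel" "(k', k'') \<in> spinc_rel"
    from kk(1) obtain x where x: "k \<in> char_vectors \<Gamma>" "k' \<in> char_vectors \<Gamma>" "x \<in> carrier_vec s"
      "\<And>i. i < s \<Longrightarrow> k' $ i = k $ i + 2 * (M *\<^sub>v x) $ i" by (rule spinc_relE) blast
    from kk(2) obtain y where y: "k'' \<in> char_vectors \<Gamma>" "y \<in> carrier_vec s"
      "\<And>i. i < s \<Longrightarrow> k'' $ i = k' $ i + 2 * (M *\<^sub>v y) $ i" by (rule spinc_relE) blast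
    show "(k, k'') \<in> spinc_rel"
      using x y index_M_mult_add(1)[OF x(3) y(2)]
      by (intro spinc_relI[where x = "x + y"]) (auto simp del: index_mult_mat_vec)
  qed
qed

text \<open>As \<open>hM\<^sup>-\<^sup>1\<close> is integral, \<open>2h\<int>\<^sup>s\<close> is contained in \<open>2M\<int>\<^sup>s\<close>; so every class has a representative with entries
  in \<open>{0..<2h}\<close>.\<close>

lemma finite_spinc: "finite (spinc \<Gamma>)"
proof -
  define V where "V = vec s ` ({..<s} \<rightarrow>\<^sub>E {0..<2 * h})"
  have "finite V" unfolding V_def by (intro finite_imageI finite_PiE) auto
  moreover have "spinc \<Gamma> \<subseteq> (\<lambda>v. spinc_rel `` {v}) ` V"
  proof
    fix K assume "K \<in> spinc \<Gamma>"
    then obtain k where k: "k \<in> char_vectors \<Gamma>" "K = spinc_rel `` {k}"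
      unfolding spinc_eq by (auto elim: quotientE)
    \<comment> \<open>Reduce \<open>k\<close> modulo \<open>2h\<close>; the difference \<open>2hq\<close> equals \<open>2M(M'q)\<close>.\<close>
    define v where "v = vec s (restrict (\<lambda>i. k $ i mod (2 * h)) {..<s})"
    define q where "q = vec s (\<lambda>i. k $ i div (2 * h))"
    have v: "v $ i = k $ i mod (2 * h)" if "i < s" for i using that by (simp add: v_def)
    have "restrict (\<lambda>i. k $ i mod (2 * h)) {..<s} \<in> {..<s} \<rightarrow>\<^sub>E {0..<2 * h}"
      by (subst restrict_PiE_iff) (use h_pos in simp)
    then have "v \<in> V" unfolding v_def V_def by (rule imageI)
    have q: "q \<in> carrier_vec s" by (simp add: q_def)
    have step: "k $ i = v $ i + 2 * (M *\<^sub>v (M' *\<^sub>v q)) $ i" if "i < s" for i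
    proof -
      have "(M *\<^sub>v (M' *\<^sub>v q)) $ i = h * (k $ i div (2 * h))"
        using that M_M'_vec[OF q] by (simp add: q_def del: index_mult_mat_vec)
      then show ?thesis using that mult_div_mod_eq[of "2 * h" "k $ i"] by (simp add: v algebra_simps)
    qed
    have "even (v $ i) \<longleftrightarrow> even (k $ i)" if "i < s" for i
      using step[OF that] by simp
    then have "v \<in> char_vectors \<Gamma>" using k(1) by (auto simp: char_vectors_def v_def)
    then have "(v, k) \<in> spinc_rel"
      using k(1) step q by (intro spinc_relI[where x = "M' *\<^sub>v q"]) auto
    then have "spinc_rel `` {v} = K"
      using equiv_class_eq[OF equiv_spinc_rel] k(2) by simp
    then show "K \<in> (\<lambda>v. spinc_rel `` {v}) ` V" using \<open>v \<in> V\<close> by auto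
  qed
  ultimately show ?thesis by (rule finite_surj)
qed

definition rep :: "int vec set \<Rightarrow> int vec" where
  "rep K = (SOME k. k \<in> K)"

lemma rep:
  assumes "K \<in> spinc \<Gamma>"
  shows "rep K \<in> char_vectors \<Gamma>" "K = spinc_rel `` {rep K}"
proof -
  obtain k where k: "k \<in> char_vectors \<Gamma>" "K = spinc_rel `` {k}"
    using assms unfolding spinc_eq by (auto elim: quotientE)
  then have "k \<in> K" using equiv_class_self[OF equiv_spinc_rel] by simp
  then have "rep K \<in> K" unfolding rep_def by (rule someI)
  then have "(k, rep K) \<in> spinc_rel" using k by simp
  then show "rep K \<in> char_vectors \<Gamma>" "K = spinc_rel `` {rep K}"
    using equiv_class_eq[OF equiv_spinc_rel, of k "rep K"] k(2) by (auto elim: spinc_relE)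
qed

lemma shifted_index:
  assumes "k \<in> carrier_vec s" "x \<in> carrier_vec s" "i < s"
  shows "shifted k x $ i = 2 * (M *\<^sub>v x) $ i + k $ i - (M *\<^sub>v ones \<Gamma>) $ i"
  using assms M_mult_carrier[OF assms(2)] M_mult_carrier[OF ones_carrier]
  by (simp add: shifted_def del: M_mult_carrier index_mult_mat_vec)

text \<open>Equality of the shifted vectors puts the two representatives into one class; then they coincide, and
  \<open>M\<close> is injective.\<close>

lemma shifted_rep_inj:
  assumes K: "K \<in> spinc \<Gamma>" "K' \<in> spinc \<Gamma>" and x: "x \<in> carrier_vec s" "x' \<in> carrier_vec s"
    and eq: "shifted (rep K) x = shifted (rep K') x'"
  shows "K = K'" "x = x'"
proof -
  note k = rep(1)[OF K(1)] rep(1)[OF K(2)]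
  have idx: "2 * (M *\<^sub>v x) $ i + rep K $ i = 2 * (M *\<^sub>v x') $ i + rep K' $ i" if "i < s" for i
    using arg_cong[OF eq, of "\<lambda>v. v $ i"] shifted_index[OF char_vectors_carrier[OF k(1)] x(1) that]
      shifted_index[OF char_vectors_carrier[OF k(2)] x(2) that] by simp
  have "(rep K, rep K') \<in> spinc_rel"
  proof (rule spinc_relI[OF k, where x = "x - x'"])
    fix i assume i: "i < s"
    show "rep K' $ i = rep K $ i + 2 * (M *\<^sub>v (x - x')) $ i"
      using idx[OF i] index_M_mult_add(2)[OF x i] by simp
  qed (use x in simp)
  then show KK: "K = K'"
    using equiv_class_eq[OF equiv_spinc_rel] rep(2)[OF K(1)] rep(2)[OF K(2)] by metis
  have "M *\<^sub>v x = M *\<^sub>v x'"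
  proof (rule eq_vecI)
    fix i assume "i < dim_vec (M *\<^sub>v x')"
    then show "(M *\<^sub>v x) $ i = (M *\<^sub>v x') $ i" using idx[of i] KK by simp
  qed simp
  then show "x = x'" by (rule M_mult_inj[OF x])
qed

text \<open>The vector \<open>leaf_vec n e + Mu\<close> is characteristic, and its class contains a representative that differs
  from it by some \<open>2Mx\<close>.\<close>

lemma shifted_rep_surj:
  assumes n: "odd n" and e: "e \<in> signs"
  obtains K x where "K \<in> spinc \<Gamma>" "x \<in> carrier_vec s" "shifted (rep K) x = leaf_vec n e"
proof -
  define k where "k = leaf_vec n e + M *\<^sub>v ones \<Gamma>"
  have k: "k \<in> carrier_vec s" by (simp add: k_def)
  have z: "0\<^sub>v s \<in> carrier_vec s" by simp
  have ki: "k $ i = leaf_vec n e $ i + (M *\<^sub>v ones \<Gamma>) $ i" if "i < s" for i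
    using that M_mult_carrier[OF ones_carrier]
    by (simp add: k_def del: M_mult_carrier index_mult_mat_vec)
  have "shifted k (0\<^sub>v s) $ i = leaf_vec n e $ i" if "i < s" for i
    using that shifted_index[OF k z that] ki[OF that] by (simp add: scalar_prod_def)
  moreover have "odd (e i)" if "i \<in> legs" for i using e that by (auto simp: signs_def PiE_iff)
  ultimately have char: "k \<in> char_vectors \<Gamma>"
    unfolding char_vectors_iff_shifted[OF k z]
    using n s_pos pos_range(2) by (auto simp: leaf_vec_leg)
  define K where "K = spinc_rel `` {k}"
  have K: "K \<in> spinc \<Gamma>" unfolding spinc_eq K_def by (rule quotientI[OF char])
  have "k \<in> K" unfolding K_def by (rule equiv_class_self[OF equiv_spinc_rel char])
  then have "(rep K, k) \<in> spinc_rel" using rep(2)[OF K] by blast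
  then obtain x where x: "x \<in> carrier_vec s"
    "\<And>i. i < s \<Longrightarrow> k $ i = rep K $ i + 2 * (M *\<^sub>v x) $ i" by (rule spinc_relE) blast
  note rc = char_vectors_carrier[OF rep(1)[OF K]]
  have "shifted (rep K) x = leaf_vec n e"
  proof (rule eq_vecI)
    fix i assume "i < dim_vec (leaf_vec n e)"
    then have i: "i < s" by (simp add: leaf_vec_def)
    show "shifted (rep K) x $ i = leaf_vec n e $ i"
      using shifted_index[OF rc x(1) i] x(2)[OF i] ki[OF i] by simp
  qed (use carrier_vecD[OF shifted_carrier[OF rc x(1)]] in \<open>simp add: leaf_vec_def\<close>)
  then show ?thesis using that K x by blast
qed

text \<open>The pairs of a spin-c structure and a lattice vector with nonzero weight correspond bijectively to the
  pairs \<open>(n, e)\<close> with nonzero weight, with matching exponents.\<close>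

lemma P_inf_0_eq:
  assumes W: "admissible_family W"
  shows "subst_powers (rat_of_int h) 2 (P_inf_0 W \<Gamma>) (\<alpha>, \<tau>) =
    (\<Sum>(n, e)\<in>{(n, e). n \<in> {n. odd n} \<and> e \<in> signs \<and>
        rat_of_int ((z_exp a n e)\<^sup>2) / (4 * rat_of_int A) = \<alpha> - Delta a \<Gamma> \<and> rat_of_int (t_exp n e) = \<tau>}.
     (if n > 0 then W 3 1 else W 3 1 - 1) * - of_int (sign_prod e))"
proof -
  define wt :: "int \<times> (nat \<Rightarrow> int) \<Rightarrow> real"
    where "wt y = (if fst y > 0 then W 3 1 else W 3 1 - 1) * - of_int (sign_prod (snd y))" for y
  define Y where "Y = {y \<in> {n. odd n} \<times> signs. rat_of_int ((z_exp a (fst y) (snd y))\<^sup>2) / (4 * rat_of_int A)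
      = \<alpha> - Delta a \<Gamma> \<and> rat_of_int (t_exp (fst y) (snd y)) = \<tau>}"
  define Y' where "Y' = {y \<in> Y. wt y \<noteq> 0}"
  define X where "X K = {x \<in> carrier_vec s. W_graph W \<Gamma> (rep K) x \<noteq> 0 \<and> eps \<Gamma> (rep K) x = \<alpha> / rat_of_int h \<and>
      Theta \<Gamma> (rep K) + rat_of_int (lat_form \<Gamma> x (ones \<Gamma>)) = \<tau> / 2}" for K
  define \<psi> where "\<psi> p = (shifted (rep (fst p)) (snd p) $ 0,
      restrict (\<lambda>i. shifted (rep (fst p)) (snd p) $ i) legs)" for p
  have "Y \<subseteq> {y \<in> {n. odd n} \<times> signs. t_exp (fst y) (snd y) = \<lfloor>\<tau>\<rfloor>}" by (auto simp: Y_def)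
  then have finY: "finite Y" by (rule finite_subset) (rule finite_t_exp_fibre)
  have h0: "rat_of_int h \<noteq> 0" using h_pos by simp
  have in_X: "x \<in> X K \<longleftrightarrow> (n, e) \<in> Y'"
    and wt: "W_graph W \<Gamma> (rep K) x = wt (n, e)"
    if K: "K \<in> spinc \<Gamma>" and x: "x \<in> carrier_vec s" and n: "odd n" and e: "e \<in> signs"
      and sh: "shifted (rep K) x = leaf_vec n e" for K x n e
  proof -
    note rc = char_vectors_carrier[OF rep(1)[OF K]]
    show wt: "W_graph W \<Gamma> (rep K) x = wt (n, e)"
      using W_graph_leaf_vec[OF W e n sh] by (simp add: wt_def)
    have "eps \<Gamma> (rep K) x = \<alpha> / rat_of_int h \<longleftrightarrow> rat_of_int h * eps \<Gamma> (rep K) x = \<alpha>"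
      using h0 by (auto simp: field_simps)
    also have "\<dots> \<longleftrightarrow> rat_of_int ((z_exp a n e)\<^sup>2) / (4 * rat_of_int A) = \<alpha> - Delta a \<Gamma>"
      unfolding eps_leaf_vec[OF rc x e sh] by (auto simp: algebra_simps)
    finally have q: "eps \<Gamma> (rep K) x = \<alpha> / rat_of_int h \<longleftrightarrow> \<dots>" .
    have t: "Theta \<Gamma> (rep K) + rat_of_int (lat_form \<Gamma> x (ones \<Gamma>)) = \<tau> / 2 \<longleftrightarrow>
        rat_of_int (t_exp n e) = \<tau>"
      unfolding Theta_shifted[OF rc x] sh leaf_vec_ones by simp
    show "x \<in> X K \<longleftrightarrow> (n, e) \<in> Y'"
    proof -
      have "x \<in> X K \<longleftrightarrow> wt (n, e) \<noteq> 0 \<and> rat_of_int ((z_exp a n e)\<^sup>2) / (4 * rat_of_int A) = \<alpha> - Delta a \<Gamma> \<and>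
          rat_of_int (t_exp n e) = \<tau>"
        unfolding X_def mem_Collect_eq wt q t using x by blast
      also have "\<dots> \<longleftrightarrow> (n, e) \<in> Y'" using n e by (auto simp: Y'_def Y_def)
      finally show ?thesis .
    qed
  qed
  have from_X: "odd (fst (\<psi> (K, x)))" "snd (\<psi> (K, x)) \<in> signs"
      "shifted (rep K) x = leaf_vec (fst (\<psi> (K, x))) (snd (\<psi> (K, x)))"
    if K: "K \<in> spinc \<Gamma>" and x: "x \<in> X K" for K x
    using W_graph_nonzero[OF W rep(1)[OF K], of x] x by (auto simp: X_def \<psi>_def)
  have bij: "bij_betw \<psi> (SIGMA K:spinc \<Gamma>. X K) Y'"
  proof (rule bij_betw_imageI)
    show "inj_on \<psi> (SIGMA K:spinc \<Gamma>. X K)"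
    proof (rule inj_onI, clarify)
      fix K x K' x'
      assume K: "K \<in> spinc \<Gamma>" "x \<in> X K" "K' \<in> spinc \<Gamma>" "x' \<in> X K'" and eq: "\<psi> (K, x) = \<psi> (K', x')"
      have "shifted (rep K) x = shifted (rep K') x'"
        using from_X(3)[OF K(1,2)] from_X(3)[OF K(3,4)] eq by simp
      moreover have "x \<in> carrier_vec s" "x' \<in> carrier_vec s" using K by (simp_all add: X_def)
      ultimately show "K = K' \<and> x = x'" using shifted_rep_inj[OF K(1,3)] by blast
    qed
    show "\<psi> ` (SIGMA K:spinc \<Gamma>. X K) = Y'"
    proof (intro equalityI subsetI)
      fix y assume "y \<in> \<psi> ` (SIGMA K:spinc \<Gamma>. X K)"
      then obtain K x where K: "K \<in> spinc \<Gamma>" "x \<in> X K" and y: "y = \<psi> (K, x)" by auto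
      have "x \<in> carrier_vec s" using K by (simp add: X_def)
      from in_X[OF K(1) this from_X[OF K]] show "y \<in> Y'" using K y by simp
    next
      fix y assume y: "y \<in> Y'"
      obtain n e where ne: "y = (n, e)" by (cases y)
      then have n: "odd n" and e: "e \<in> signs" using y by (auto simp: Y'_def Y_def)
      obtain K x where K: "K \<in> spinc \<Gamma>" "x \<in> carrier_vec s" "shifted (rep K) x = leaf_vec n e"
        using shifted_rep_surj[OF n e] .
      have "x \<in> X K" using in_X[OF K(1,2) n e K(3)] y ne by simp
      moreover have "restrict (\<lambda>i. leaf_vec n e $ i) legs = e"
        using e by (auto simp: signs_def PiE_iff extensional_def restrict_def fun_eq_iff)
      then have "\<psi> (K, x) = y" using K(3) ne by (simp add: \<psi>_def)
      ultimately show "y \<in> \<psi> ` (SIGMA K:spinc \<Gamma>. X K)" using K(1) by (intro image_eqI[of _ _ "(K, x)"]) auto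
    qed
  qed
  have "finite Y'" using finY by (simp add: Y'_def)
  then have finS: "finite (SIGMA K:spinc \<Gamma>. X K)" using bij_betw_finite[OF bij] by simp
  have finX: "finite (X K)" if "K \<in> spinc \<Gamma>" for K
  proof (rule finite_subset)
    show "X K \<subseteq> snd ` (SIGMA K:spinc \<Gamma>. X K)" using that by force
  qed (use finS in simp)
  have "subst_powers (rat_of_int h) 2 (P_inf_0 W \<Gamma>) (\<alpha>, \<tau>) =
      (\<Sum>K\<in>spinc \<Gamma>. \<Sum>x\<in>X K. W_graph W \<Gamma> (rep K) x)"
    by (simp add: subst_powers_def P_inf_0_def P_inf_def P_inf_rep_def monomial_sum_def X_def rep_def)
  also have "\<dots> = (\<Sum>p\<in>(SIGMA K:spinc \<Gamma>. X K). W_graph W \<Gamma> (rep (fst p)) (snd p))"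
    using finite_spinc finX by (subst sum.Sigma) (auto simp: case_prod_unfold)
  also have "\<dots> = (\<Sum>p\<in>(SIGMA K:spinc \<Gamma>. X K). wt (\<psi> p))"
  proof (rule sum.cong[OF refl], clarify)
    fix K x assume K: "K \<in> spinc \<Gamma>" "x \<in> X K"
    have "x \<in> carrier_vec s" using K by (simp add: X_def)
    from wt[OF K(1) this from_X[OF K]]
    show "W_graph W \<Gamma> (rep (fst (K, x))) (snd (K, x)) = wt (\<psi> (K, x))" by simp
  qed
  also have "\<dots> = (\<Sum>y\<in>Y'. wt y)" by (rule sum.reindex_bij_betw[OF bij])
  also have "\<dots> = (\<Sum>y\<in>Y. wt y)"
    unfolding Y'_def using finY by (intro sum.mono_neutral_left) auto
  also have "\<dots> = (\<Sum>(n, e)\<in>{(n, e). n \<in> {n. odd n} \<and> e \<in> signs \<and>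
        rat_of_int ((z_exp a n e)\<^sup>2) / (4 * rat_of_int A) = \<alpha> - Delta a \<Gamma> \<and> rat_of_int (t_exp n e) = \<tau>}.
     (if n > 0 then W 3 1 else W 3 1 - 1) * - of_int (sign_prod e))"
    by (intro sum.cong) (auto simp: Y_def wt_def)
  finally show ?thesis .
qed

lemma P_inf_0_asym_expansion:
  assumes W: "admissible_family W"
  shows "subst_powers (rat_of_int (H1_order \<Gamma>)) 2 (P_inf_0 W \<Gamma>) =
         q_power_times (Delta a \<Gamma>) (laplace A (asym_expansion A (W 3 1) (f0 a)))"
proof
  fix p :: "rat \<times> rat"
  obtain \<alpha> \<tau> where p: "p = (\<alpha>, \<tau>)" by (cases p)
  have "A \<noteq> 0" using A_pos by simp
  then show "subst_powers (rat_of_int (H1_order \<Gamma>)) 2 (P_inf_0 W \<Gamma>) p =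
      q_power_times (Delta a \<Gamma>) (laplace A (asym_expansion A (W 3 1) (f0 a))) p"
    unfolding p H1_order_eq P_inf_0_eq[OF W] q_power_times_def asym_expansion_f0 case_prod_conv
    by (subst laplace_collected) simp_all
qed

end

theorem theorem1p3:
  fixes W :: "nat \<Rightarrow> int \<Rightarrow> real"
    and \<Gamma> :: plumbing
    and b :: int
    and a \<beta> :: "nat \<Rightarrow> int"
  assumes "admissible_family W"
    and "\<forall>i \<in> {1, 2, 3}. a i > 0 \<and> coprime (a i) (\<beta> i)"
    and "seifert_plumbing b a \<beta> \<Gamma>"
    and "negative_definite \<Gamma>"
    and "betti_1 \<Gamma> = 0"
  shows "subst_powers (rat_of_int (H1_order \<Gamma>)) 2 (P_inf_0 W \<Gamma>) =
         q_power_times (Delta a \<Gamma>)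
           (laplace (prod_a a) (asym_expansion (prod_a a) (W 3 1) (f0 a)))"
proof -
  obtain c pos where legs:
      "\<forall>i \<in> legs. c i \<noteq> [] \<and> rat_of_int (a i) / rat_of_int (\<beta> i) = neg_cfrac (c i)"
      "nverts \<Gamma> = 1 + (\<Sum>i \<in> legs. length (c i))"
      "bij_betw (\<lambda>(i, j). pos i j) (SIGMA i : legs. {..<length (c i)}) {1..<nverts \<Gamma>}"
      "\<forall>i \<in> legs. pos i (length (c i) - 1) = i"
      "weight \<Gamma> 0 = - b"
      "\<forall>i \<in> legs. \<forall>j < length (c i). weight \<Gamma> (pos i j) = - (c i ! j)"
      "edges \<Gamma> = {{0, pos i 0} | i. i \<in> legs} \<union>
        {{pos i j, pos i (Suc j)} | i j. i \<in> legs \<and> Suc j < length (c i)}"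
    using assms(3) unfolding seifert_plumbing_def legs_def[symmetric] by (elim exE conjE) (rule that)
  interpret star_plumbing \<Gamma> b a \<beta> c pos
    by unfold_locales (use legs assms(2,4)[folded legs_def] in \<open>simp_all only: not_False_eq_True\<close>)
  show ?thesis by (rule P_inf_0_asym_expansion[OF assms(1)])
qed

end
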